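(* Let $n$ be a positive odd integer and $Q(z)=-\pi^2(n/2)^2E_4(z)$. Let $y_\pm(z)=q^{\pm n/4}\bigl(1+\sum_{j\ge1}c_j^\pm q^j\bigr)$ be the solutions of $y''=Q(z)y$ on $\mathbb H$, and let $F(z)=y_-(z)^2+c\,y_+(z)^2$, where $c\in\mathbb C$ is the constant such that $\bigl(F|_{-2}T\bigr)(z)=\bigl(F|_{-2}S\bigr)(z)=-F(z)$. Then there is a polynomial $P_{n-1}(x)\in\mathbb Q[x]$ of degree $(n-1)/2$ such that $$F(z)=\frac{E_4(z)}{\Delta(z)^{1/2}}P_{n-1}(j(z)).$$
   Context: $\mathbb H$ is the upper half-plane, $q=e^{2\pi iz}$ (with $q^s=e^{2\pi isz}$), $'=d/dz$. $E_4(z)=1+240\sum_{m\ge1}\frac{m^3q^m}{1-q^m}$ and $E_6(z)=1-504\sum_{m\ge1}\frac{m^5q^m}{1-q^m}$ are the Eisenstein series of weights $4$ and $6$ on $\mathrm{SL}(2,\mathbb Z)$, $\Delta=(E_4^3-E_6^2)/1728=q-24q^2+\cdots$, $\Delta^{1/2}=q^{1/2}+\cdots$ is the holomorphic square root $\eta^{12}$, $\eta(z)=q^{1/24}\prod_{n\ge1}(1-q^n)$, and $j=E_4^3/\Delta$. $T=\begin{pmatrix}1&1\\0&1\end{pmatrix}$, $S=\begin{pmatrix}0&-1\\1&0\end{pmatrix}$, and $(F|_k\gamma)(z)=(cz+d)^{-k}F(\gamma z)$ for $\gamma=\begin{pmatrix}a&b\\c&d\end{pmatrix}$. The paper establishes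 separately that a constant $c$ with the stated property exists. *)

theory Defs
  imports "HOL-Complex_Analysis.Complex_Analysis"
begin

definition upper_half_plane :: "complex set" where
  "upper_half_plane = {z. Im z > 0}"

definition qpow :: "real \<Rightarrow> complex \<Rightarrow> complex" where
  "qpow s z = exp (2 * of_real pi * \<i> * of_real s * z)"

abbreviation nome :: "complex \<Rightarrow> complex" where
  "nome z \<equiv> qpow 1 z"

definition Eisenstein4 :: "complex \<Rightarrow> complex" where
  "Eisenstein4 z = 1 + 240 * (\<Sum>m. of_nat (Suc m) ^ 3 * nome z ^ Suc m / (1 - nome z ^ Suc m))"

definition Eisenstein6 :: "complex \<Rightarrow> complex" where
  "Eisenstein6 z = 1 - 504 * (\<Sum>m. of_nat (Suc m) ^ 5 * nome z ^ Suc m / (1 - nome z ^ Suc m))"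

definition modular_discriminant :: "complex \<Rightarrow> complex" where
  "modular_discriminant z = (Eisenstein4 z ^ 3 - Eisenstein6 z ^ 2) / 1728"

definition dedekind_eta :: "complex \<Rightarrow> complex" where
  "dedekind_eta z = qpow (1 / 24) z * (\<Prod>m. 1 - nome z ^ Suc m)"

(* The holomorphic square root q^(1/2) + ... of the discriminant; csqrt composed with the
   discriminant would pick the wrong branch on parts of the half plane. *)
definition sqrt_discriminant :: "complex \<Rightarrow> complex" where
  "sqrt_discriminant z = dedekind_eta z ^ 12"

definition klein_j :: "complex \<Rightarrow> complex" where
  "klein_j z = Eisenstein4 z ^ 3 / modular_discriminant z"

definition mat_T :: "int ^ 2 ^ 2" where
  "mat_T = vector [vector [1, 1], vector [0, 1]]"

definition mat_S :: "int ^ 2 ^ 2" where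
  "mat_S = vector [vector [0, - 1], vector [1, 0]]"

definition slash :: "(complex \<Rightarrow> complex) \<Rightarrow> int \<Rightarrow> int ^ 2 ^ 2 \<Rightarrow> complex \<Rightarrow> complex" where
  "slash F k \<gamma> z =
     (of_int (\<gamma> $ 2 $ 1) * z + of_int (\<gamma> $ 2 $ 2)) powi (- k) *
     F ((of_int (\<gamma> $ 1 $ 1) * z + of_int (\<gamma> $ 1 $ 2)) /
        (of_int (\<gamma> $ 2 $ 1) * z + of_int (\<gamma> $ 2 $ 2)))"

definition potential :: "nat \<Rightarrow> complex \<Rightarrow> complex" where
  "potential n z = - (of_real pi ^ 2 * (of_nat n / 2) ^ 2 * Eisenstein4 z)"

definition solves_ode2 :: "(complex \<Rightarrow> complex) \<Rightarrow> (complex \<Rightarrow> complex) \<Rightarrow> bool" where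
  "solves_ode2 Q y \<longleftrightarrow> y holomorphic_on upper_half_plane \<and>
     (\<forall>z\<in>upper_half_plane. (deriv ^^ 2) y z = Q z * y z)"

definition has_normalized_q_expansion :: "(complex \<Rightarrow> complex) \<Rightarrow> real \<Rightarrow> bool" where
  "has_normalized_q_expansion y s \<longleftrightarrow>
     (\<exists>a :: nat \<Rightarrow> complex. \<forall>z\<in>upper_half_plane.
        summable (\<lambda>j. a (Suc j) * nome z ^ Suc j) \<and>
        y z = qpow s z * (1 + (\<Sum>j. a (Suc j) * nome z ^ Suc j)))"

end

theory Submission
  imports Defs
begin

text \<open>The differential equation itself supplies the modularity that is needed. If \<open>F\<close> is a quadratic
  form in two solutions of \<open>y'' = Q y\<close>, then \<open>2 F F'' - F'\<^sup>2 - 4 Q F\<^sup>2\<close> is constant, while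
  \<open>2 F F'' - F'\<^sup>2\<close> has weight \<open>0\<close> when \<open>F\<close> has weight \<open>-2\<close>; hence \<open>E\<^sub>4\<close> has weight \<open>4\<close>.
  Ramanujan's differential equations, which follow from an elementary rearrangement of the sums
  over \<open>a x + b y = n\<close>, give both \<open>\<Delta> = \<eta>\<^sup>2\<^sup>4\<close> (as \<open>\<Delta>\<close> has logarithmic derivative \<open>E\<^sub>2\<close>) and
  \<open>960 \<Delta> = 4 E\<^sub>4 D\<^sup>2E\<^sub>4 - 5 (D E\<^sub>4)\<^sup>2\<close> with \<open>D = q d/dq\<close>, hence the transformation laws of \<open>\<Delta>\<close>
  and \<open>\<Delta>\<^sup>1\<^sup>/\<^sup>2\<close>.

  Now \<open>F E\<^sub>4\<^sup>2 / \<Delta>\<^sup>1\<^sup>/\<^sup>2\<close> is invariant and holomorphic on the upper half-plane, with a pole of order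
  \<open>N = (n + 1) / 2\<close> at the cusp, so it is a polynomial \<open>R(j)\<close> of degree \<open>N\<close>. Evaluation at a zero of
  \<open>E\<^sub>4\<close> gives \<open>R(0) = 0\<close>, and \<open>R(j) = j P(j)\<close> yields the claim. The coefficients of \<open>P\<close> only depend
  on the terms \<open>q\<^sup>-\<^sup>N, \<dots>, q\<^sup>-\<^sup>1\<close>, which come from \<open>y\<^sub>-\<^sup>2\<close> alone and are rational by the recurrence
  for the coefficients of \<open>y\<^sub>-\<close>.\<close>

section \<open>Convolution identities for divisor sums\<close>

text \<open>At \<open>n = 0\<close> the index set is infinite, so the sum takes its default value 0.
  Hence the generating series start at \<open>q\<close>, and convolutions may run over all
  \<open>m \<le> n\<close>.\<close>

definition divisor_sum :: "nat \<Rightarrow> nat \<Rightarrow> complex" where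
  "divisor_sum k n = (\<Sum>d | d dvd n. of_nat d ^ k)"

text \<open>\<open>a\<close> and \<open>b\<close> are divisors of the two positive summands of
  \<open>n\<close>, with cofactors \<open>x\<close> and \<open>y\<close>.\<close>

definition quads :: "nat \<Rightarrow> (nat \<times> nat \<times> nat \<times> nat) set" where
  "quads n = {(a, b, x, y). 0 < a \<and> 0 < b \<and> 0 < x \<and> 0 < y \<and> a * x + b * y = n}"

lemma sigma_0 [simp]: "divisor_sum k 0 = 0"
  by (simp add: divisor_sum_def)

lemma finite_quads: "finite (quads n)"
proof (rule finite_subset)
  show "quads n \<subseteq> {..n} \<times> {..n} \<times> {..n} \<times> {..n}"
  proof safe
    fix a b x y assume "(a, b, x, y) \<in> quads n"
    hence *: "0 < a" "0 < b" "0 < x" "0 < y" "a * x + b * y = n" by (auto simp: quads_def)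
    have "a * 1 \<le> a * x" "1 * x \<le> a * x" "b * 1 \<le> b * y" "1 * y \<le> b * y"
      using * by (intro mult_le_mono; simp)+
    thus "a \<le> n" "b \<le> n" "x \<le> n" "y \<le> n" using *(5) by linarith+
  qed
qed auto

lemma sum_divisor_pairs:
  fixes f :: "nat \<Rightarrow> nat \<Rightarrow> 'a :: comm_monoid_add"
  assumes "m > 0"
  shows "(\<Sum>(a, x) | a * x = m. f a x) = (\<Sum>d | d dvd m. f d (m div d))"
  using assms
  by (intro sum.reindex_bij_witness[of _ "\<lambda>d. (d, m div d)" fst]) auto

text \<open>Group the quadruples by \<open>m = a * x\<close>. The end terms \<open>m = 0\<close> and
  \<open>m = n\<close> of the convolution vanish by \<open>sigma_0\<close>.\<close>

lemma sum_quads_sigma: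
  "(\<Sum>(a, b, x, y)\<in>quads n. of_nat a ^ j * of_nat b ^ k) = (\<Sum>m\<le>n. divisor_sum j m * divisor_sum k (n - m))"
proof -
  have *: "divisor_sum j m = (\<Sum>(a, x) | a * x = m. of_nat a ^ j)" if "m > 0" for j m
    using sum_divisor_pairs[OF that, of "\<lambda>a x. of_nat a ^ j :: complex"] by (simp add: divisor_sum_def)
  have fin: "finite {(a, x). a * x = m}" if "m > 0" for m :: nat
  proof (rule finite_subset)
    show "{(a, x). a * x = m} \<subseteq> {..m} \<times> {..m}" using that by auto
  qed auto
  have "(\<Sum>m\<le>n. divisor_sum j m * divisor_sum k (n - m)) = (\<Sum>m\<in>{0<..<n}. divisor_sum j m * divisor_sum k (n - m))"
    by (rule sum.mono_neutral_right) (auto simp: not_less intro!: le_neq_implies_less Nat.gr0I)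
  also have "\<dots> = (\<Sum>m\<in>{0<..<n}. \<Sum>p\<in>{(a, x). a * x = m} \<times> {(b, y). b * y = n - m}.
                   (case p of ((a, x), (b, y)) \<Rightarrow> of_nat a ^ j * of_nat b ^ k))"
    by (intro sum.cong refl) (simp add: * sum_product sum.cartesian_product case_prod_unfold)
  also have "\<dots> = (\<Sum>(m, p)\<in>(SIGMA m:{0<..<n}. {(a, x). a * x = m} \<times> {(b, y). b * y = n - m}).
                   (case p of ((a, x), (b, y)) \<Rightarrow> of_nat a ^ j * of_nat b ^ k))"
    by (intro sum.Sigma) (auto intro!: fin finite_cartesian_product)
  also have "\<dots> = (\<Sum>(a, b, x, y)\<in>quads n. of_nat a ^ j * of_nat b ^ k)"
    by (rule sum.reindex_bij_witness[of _ "\<lambda>(a, b, x, y). (a * x, ((a, x), (b, y)))"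
          "\<lambda>(m, ((a, x), (b, y))). (a, b, x, y)"]) (auto simp: quads_def intro!: Nat.gr0I)
  finally show ?thesis ..
qed

text \<open>A quadruple with \<open>x > y\<close> satisfies \<open>a x + b y = a (x - y) + (a + b) y\<close>; this
  matches the part \<open>x > y\<close> of the sum of \<open>h(a, b)\<close> with the part \<open>a < b\<close> of the sum of
  \<open>h(a, b - a)\<close>, and only the diagonals remain (Skoruppa).\<close>

lemma sum_quads_telescope:
  fixes h :: "complex \<Rightarrow> complex \<Rightarrow> complex"
  assumes sym: "\<And>a b. h a b = h b a" and sym': "\<And>a b. h a (b - a) = h b (a - b)"
  assumes n: "n > 0"
  shows "(\<Sum>(a, b, x, y)\<in>quads n. h (of_nat a) (of_nat b) - h (of_nat a) (of_nat b - of_nat a)) =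
     (\<Sum>d | d dvd n. (\<Sum>a<d. h (of_nat a) (of_nat d - of_nat a)) - of_nat (n div d) * h (of_nat d) 0)"
proof -
  define H where "H = (\<lambda>(a::nat, b::nat, x::nat, y::nat). h (of_nat a) (of_nat b))"
  define G where "G = (\<lambda>(a::nat, b::nat, x::nat, y::nat). h (of_nat a) (of_nat b - of_nat a))"
  define S where "S = (\<lambda>f (P :: nat \<Rightarrow> nat \<Rightarrow> nat \<Rightarrow> nat \<Rightarrow> bool).
     (\<Sum>q\<in>{(a, b, x, y). (a, b, x, y) \<in> quads n \<and> P a b x y}. f q :: complex))"
  have fin: "finite {(a, b, x, y). (a, b, x, y) \<in> quads n \<and> P a b x y}" for P
    by (rule finite_subset[OF _ finite_quads[of n]]) auto
  have split: "sum f (quads n) = S f P + S f Q + S f R"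
    if "\<And>a b x y. P a b x y \<or> Q a b x y \<or> R a b x y"
       "\<And>a b x y. \<not> (P a b x y \<and> Q a b x y)" "\<And>a b x y. \<not> (P a b x y \<and> R a b x y)"
       "\<And>a b x y. \<not> (Q a b x y \<and> R a b x y)" for f P Q R
  proof -
    have "quads n = {(a, b, x, y). (a, b, x, y) \<in> quads n \<and> P a b x y} \<union>
            {(a, b, x, y). (a, b, x, y) \<in> quads n \<and> Q a b x y} \<union>
            {(a, b, x, y). (a, b, x, y) \<in> quads n \<and> R a b x y}"
      using that(1) by auto
    hence "sum f (quads n) = sum f \<dots>" by simp
    also have "\<dots> = S f P + S f Q + S f R"
    proof -
      have "sum f (A \<union> B \<union> C) = sum f A + sum f B + sum f C"
        if "finite A" "finite B" "finite C" "A \<inter> B = {}" "A \<inter> C = {}" "B \<inter> C = {}" for A B C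
        using that by (simp add: sum.union_disjoint Int_Un_distrib2)
      thus ?thesis unfolding S_def by this (rule fin | use that in blast)+
    qed
    finally show ?thesis .
  qed
  have H: "sum H (quads n) = S H (\<lambda>a b x y. x > y) + S H (\<lambda>a b x y. x < y) + S H (\<lambda>a b x y. x = y)"
    by (rule split) auto
  have G: "sum G (quads n) = S G (\<lambda>a b x y. a < b) + S G (\<lambda>a b x y. a > b) + S G (\<lambda>a b x y. a = b)"
    by (rule split) auto
  have 1: "S H (\<lambda>a b x y. x < y) = S H (\<lambda>a b x y. x > y)" unfolding S_def
    by (rule sum.reindex_bij_witness[of _ "\<lambda>(a, b, x, y). (b, a, y, x)" "\<lambda>(a, b, x, y). (b, a, y, x)"])
       (auto simp: quads_def H_def intro: sym)
  have 2: "S G (\<lambda>a b x y. a > b) = S G (\<lambda>a b x y. a < b)" unfolding S_def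
    by (rule sum.reindex_bij_witness[of _ "\<lambda>(a, b, x, y). (b, a, y, x)" "\<lambda>(a, b, x, y). (b, a, y, x)"])
       (auto simp: quads_def G_def intro: sym')
  have 3: "S H (\<lambda>a b x y. x > y) = S G (\<lambda>a b x y. a < b)" unfolding S_def
  proof (rule sum.reindex_bij_witness[of _ "\<lambda>(a, b, x, y). (a, b - a, x + y, y)"
          "\<lambda>(a, b, x, y). (a, a + b, x - y, y)"], goal_cases)
    case (4 q)
    thus ?case
      by (auto simp: quads_def algebra_simps dest!: less_imp_Suc_add)
  next
    case (2 q)
    thus ?case
      by (auto simp: quads_def algebra_simps dest!: less_imp_Suc_add)
  qed (auto simp: quads_def H_def G_def)
  \<comment> \<open>On the diagonal \<open>x = y\<close> the constraint reads
    \<open>(a + b) * x = n\<close>, so \<open>d = a + b\<close> is a divisor of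
    \<open>n\<close>.\<close>
  have 4: "S H (\<lambda>a b x y. x = y) = (\<Sum>d | d dvd n. \<Sum>a\<in>{0<..<d}. h (of_nat a) (of_nat d - of_nat a))"
  proof -
    have "(\<Sum>d | d dvd n. \<Sum>a\<in>{0<..<d}. h (of_nat a) (of_nat d - of_nat a)) =
          (\<Sum>(d, a)\<in>(SIGMA d:{d. d dvd n}. {0<..<d}). h (of_nat a) (of_nat d - of_nat a))"
      using n by (intro sum.Sigma) auto
    also have "\<dots> = S H (\<lambda>a b x y. x = y)" unfolding S_def using n
      by (intro sum.reindex_bij_witness[of _ "\<lambda>(a, b, x, y). (a + b, a)"
            "\<lambda>(d, a). (a, d - a, n div d, n div d)"])
         (auto simp: quads_def H_def of_nat_diff simp flip: distrib_right intro!: Nat.gr0I)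
    finally show ?thesis ..
  qed
  \<comment> \<open>On the diagonal \<open>a = b = d\<close> the constraint reads
    \<open>d * (x + y) = n\<close>, which leaves \<open>n div d - 1\<close> choices of
    \<open>x\<close>.\<close>
  have 5: "S G (\<lambda>a b x y. a = b) = (\<Sum>d | d dvd n. (of_nat (n div d) - 1) * h (of_nat d) 0)"
  proof -
    have "(\<Sum>d | d dvd n. (of_nat (n div d) - 1) * h (of_nat d) 0) =
          (\<Sum>d | d dvd n. \<Sum>x\<in>{0<..<n div d}. h (of_nat d) 0)"
    proof (intro sum.cong refl)
      fix d assume "d \<in> {d. d dvd n}"
      hence "n div d > 0" using n by (auto elim!: dvdE)
      hence "of_nat (n div d) - 1 = (of_nat (n div d - 1) :: complex)"
        by (simp add: of_nat_diff)
      thus "(of_nat (n div d) - 1) * h (of_nat d) 0 = (\<Sum>x\<in>{0<..<n div d}. h (of_nat d) 0)"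
        by simp
    qed
    also have "\<dots> = (\<Sum>(d, x)\<in>(SIGMA d:{d. d dvd n}. {0<..<n div d}). h (of_nat d) 0)"
      using n by (intro sum.Sigma) auto
    also have "\<dots> = S G (\<lambda>a b x y. a = b)" unfolding S_def using n
      by (intro sum.reindex_bij_witness[of _ "\<lambda>(a, b, x, y). (a, x)"
            "\<lambda>(d, x). (d, d, x, n div d - x)"])
         (auto simp: quads_def G_def simp flip: distrib_left intro!: Nat.gr0I)
    finally show ?thesis ..
  qed
  \<comment> \<open>The term for \<open>a = 0\<close> equals \<open>h d 0\<close> by symmetry;
    including it absorbs the \<open>- 1\<close> of the preceding count.\<close>
  have 6: "(\<Sum>a<d. h (of_nat a) (of_nat d - of_nat a)) =
           (\<Sum>a\<in>{0<..<d}. h (of_nat a) (of_nat d - of_nat a)) + h (of_nat d) 0" if "d > 0" for d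
  proof -
    have "{..<d} = insert 0 {0<..<d}" using that by auto
    thus ?thesis using sym[of 0 "of_nat d"] by simp
  qed
  have "(\<Sum>(a, b, x, y)\<in>quads n. h (of_nat a) (of_nat b) - h (of_nat a) (of_nat b - of_nat a)) =
        sum H (quads n) - sum G (quads n)"
    unfolding H_def G_def by (simp add: sum_subtractf case_prod_unfold)
  also have "\<dots> = S H (\<lambda>a b x y. x = y) - S G (\<lambda>a b x y. a = b)"
    unfolding H G 1 2 3 by simp
  also have "\<dots> = (\<Sum>d | d dvd n. (\<Sum>a\<in>{0<..<d}. h (of_nat a) (of_nat d - of_nat a))
                   - (of_nat (n div d) - 1) * h (of_nat d) 0)"
    unfolding 4 5 by (simp add: sum_subtractf)
  also have "\<dots> = (\<Sum>d | d dvd n. (\<Sum>a<d. h (of_nat a) (of_nat d - of_nat a)) - of_nat (n div d) * h (of_nat d) 0)"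
    using n by (intro sum.cong refl) (subst 6; auto intro!: Nat.gr0I simp: algebra_simps)
  finally show ?thesis .
qed

lemma power_sums:
  fixes d :: nat
  defines "D \<equiv> of_nat d :: complex"
  shows "(\<Sum>a<d. 1 :: complex) = D"
    "(\<Sum>a<d. of_nat a :: complex) = D ^ 2 / 2 - D / 2"
    "(\<Sum>a<d. of_nat a ^ 2 :: complex) = D ^ 3 / 3 - D ^ 2 / 2 + D / 6"
    "(\<Sum>a<d. of_nat a ^ 3 :: complex) = D ^ 4 / 4 - D ^ 3 / 2 + D ^ 2 / 4"
    "(\<Sum>a<d. of_nat a ^ 4 :: complex) = D ^ 5 / 5 - D ^ 4 / 2 + D ^ 3 / 3 - D / 30"
    "(\<Sum>a<d. of_nat a ^ 5 :: complex) = D ^ 6 / 6 - D ^ 5 / 2 + 5 * D ^ 4 / 12 - D ^ 2 / 12"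
    "(\<Sum>a<d. of_nat a ^ 6 :: complex) = D ^ 7 / 7 - D ^ 6 / 2 + D ^ 5 / 2 - D ^ 3 / 6 + D / 42"
  unfolding D_def
  by (induction d; simp add: field_simps power_numeral_reduce add_ac; algebra)+

lemma sum_divisors_div:
  assumes "n > 0"
  shows "(\<Sum>d | d dvd n. of_nat (n div d) * of_nat d ^ Suc k) = of_nat n * divisor_sum k n"
  unfolding divisor_sum_def sum_distrib_left
proof (intro sum.cong refl)
  fix d assume "d \<in> {d. d dvd n}"
  hence "of_nat n = (of_nat (n div d) * of_nat d :: complex)"
    by (metis dvd_div_mult_self mem_Collect_eq of_nat_mult)
  thus "of_nat (n div d) * of_nat d ^ Suc k = of_nat n * (of_nat d ^ k :: complex)" by simp
qed

definition sigma_conv :: "nat \<Rightarrow> nat \<Rightarrow> nat \<Rightarrow> complex" where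
  "sigma_conv j k n = (\<Sum>m\<le>n. divisor_sum j m * divisor_sum k (n - m))"

text \<open>When the sums over \<open>a < d\<close> are odd polynomials in \<open>d\<close>, summing
  over the divisors turns powers of \<open>d\<close> into divisor sums. The factor
  \<open>n div d\<close> trades one power of \<open>d\<close> for \<open>n\<close>, whence the
  exponent \<open>Suc k\<close>.\<close>

lemma sum_quads_telescope_sigma:
  fixes h :: "complex \<Rightarrow> complex \<Rightarrow> complex"
  assumes "\<And>a b. h a b = h b a" and "\<And>a b. h a (b - a) = h b (a - b)" and "n > 0"
  assumes "\<And>d. h d 0 = c * d ^ Suc k"
  assumes "\<And>d. (\<Sum>a<d. h (of_nat a) (of_nat d - of_nat a)) = 
      c7 * of_nat d ^ 7 + c5 * of_nat d ^ 5 + c3 * of_nat d ^ 3 + c1 * of_nat d ^ 1"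
  shows "(\<Sum>(a, b, x, y)\<in>quads n. h (of_nat a) (of_nat b) - h (of_nat a) (of_nat b - of_nat a)) =
     c7 * divisor_sum 7 n + c5 * divisor_sum 5 n + c3 * divisor_sum 3 n + c1 * divisor_sum 1 n
       - c * (of_nat n * divisor_sum k n)"
proof -
  have *: "c * (of_nat n * divisor_sum k n) = (\<Sum>d | d dvd n. of_nat (n div d) * (c * of_nat d ^ Suc k))"
    unfolding sum_divisors_div [OF \<open>n > 0\<close>, symmetric] by (simp only: sum_distrib_left mult.left_commute)
  show ?thesis
    unfolding *
    unfolding sum_quads_telescope[of h, OF assms(1-3)] assms(4,5) divisor_sum_def
    by (simp add: sum.distrib sum_subtractf sum_distrib_left)
qed

text \<open>Each polynomial chosen here has even degree and satisfies
  \<open>h a (b - a) = h a (- b)\<close>, so \<open>h a b - h a (b - a)\<close> is twice the part of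
  \<open>h\<close> that is odd in both variables. This is why only convolutions of odd order
  appear.\<close>

lemma
  assumes n: "n > 0"
  shows sigma_conv_1_1: "2 * sigma_conv 1 1 n = 5 / 6 * divisor_sum 3 n + 1 / 6 * divisor_sum 1 n - of_nat n * divisor_sum 1 n"
    and sigma_conv_1_3: "8 * sigma_conv 1 3 n =
      7 / 10 * divisor_sum 5 n + 1 / 3 * divisor_sum 3 n - 1 / 30 * divisor_sum 1 n - of_nat n * divisor_sum 3 n"
    and sigma_conv_1_5_3_3: "12 * sigma_conv 1 5 n + 14 * sigma_conv 3 3 n =
      83 / 140 * divisor_sum 7 n + 1 / 2 * divisor_sum 5 n - 7 / 60 * divisor_sum 3 n + 1 / 42 * divisor_sum 1 n
        - of_nat n * divisor_sum 5 n"
    and sigma_conv_3_3: "4 * sigma_conv 3 3 n = 1 / 30 * divisor_sum 7 n - 1 / 30 * divisor_sum 3 n"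
proof -
  have swap: "sigma_conv k j n = sigma_conv j k n" for j k
    unfolding sigma_conv_def by (rule sum.reindex_bij_witness[of _ "\<lambda>m. n - m" "\<lambda>m. n - m"]) auto
  note simps = sigma_conv_def sum_quads_sigma [symmetric] sum_distrib_left
    sum.distrib case_prod_unfold
  note sums = sum.distrib sum_subtractf sum_distrib_left [symmetric] power_sums

  define h1 where "h1 = (\<lambda>a b :: complex. a ^ 2 + a * b + b ^ 2)"
  have 1: "(\<Sum>a<d. h1 (of_nat a) (of_nat d - of_nat a)) =
      0 * of_nat d ^ 7 + 0 * of_nat d ^ 5 + 5 / 6 * of_nat d ^ 3 + 1 / 6 * of_nat d ^ 1" for d
  proof -
    define D where "D = (of_nat d :: complex)"
    have *: "h1 a (D - a) = D ^ 2 * 1 - D * a + a ^ 2" for a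
      unfolding h1_def by algebra
    show ?thesis unfolding D_def [symmetric]
      by (simp only: * sums) (simp add: D_def [symmetric] field_simps power_numeral_reduce)
  qed
  have "(\<Sum>(a, b, x, y)\<in>quads n. h1 (of_nat a) (of_nat b) - h1 (of_nat a) (of_nat b - of_nat a)) =
      0 * divisor_sum 7 n + 0 * divisor_sum 5 n + 5 / 6 * divisor_sum 3 n + 1 / 6 * divisor_sum 1 n
        - 1 * (of_nat n * divisor_sum 1 n)"
    by (rule sum_quads_telescope_sigma[OF _ _ n _ 1]) (auto simp: h1_def; algebra)+
  moreover have "h1 a b - h1 a (b - a) = 2 * (a ^ 1 * b ^ 1)" for a b
    unfolding h1_def by algebra
  ultimately show "2 * sigma_conv 1 1 n = 5 / 6 * divisor_sum 3 n + 1 / 6 * divisor_sum 1 n - of_nat n * divisor_sum 1 n"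
    by (simp add: simps)

  define h2 where "h2 = (\<lambda>a b :: complex. (a ^ 2 + a * b + b ^ 2) ^ 2)"
  have 2: "(\<Sum>a<d. h2 (of_nat a) (of_nat d - of_nat a)) =
      0 * of_nat d ^ 7 + 7 / 10 * of_nat d ^ 5 + 1 / 3 * of_nat d ^ 3 + (- 1 / 30) * of_nat d ^ 1" for d
  proof -
    define D where "D = (of_nat d :: complex)"
    have *: "h2 a (D - a) = D ^ 4 * 1 - (2 * D ^ 3) * a + (3 * D ^ 2) * a ^ 2 - (2 * D) * a ^ 3 + a ^ 4" for a
      unfolding h2_def by algebra
    show ?thesis unfolding D_def [symmetric]
      by (simp only: * sums) (simp add: D_def [symmetric] field_simps power_numeral_reduce)
  qed
  have "(\<Sum>(a, b, x, y)\<in>quads n. h2 (of_nat a) (of_nat b) - h2 (of_nat a) (of_nat b - of_nat a)) =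
      0 * divisor_sum 7 n + 7 / 10 * divisor_sum 5 n + 1 / 3 * divisor_sum 3 n + (- 1 / 30) * divisor_sum 1 n
        - 1 * (of_nat n * divisor_sum 3 n)"
    by (rule sum_quads_telescope_sigma[OF _ _ n _ 2]) (auto simp: h2_def; algebra)+
  moreover have "h2 a b - h2 a (b - a) = 4 * (a ^ 1 * b ^ 3) + 4 * (a ^ 3 * b ^ 1)" for a b
    unfolding h2_def by algebra
  moreover have "8 * sigma_conv 1 3 n = 4 * sigma_conv 1 3 n + 4 * sigma_conv 3 1 n"
    using swap[of 1 3] by simp
  ultimately show "8 * sigma_conv 1 3 n =
      7 / 10 * divisor_sum 5 n + 1 / 3 * divisor_sum 3 n - 1 / 30 * divisor_sum 1 n - of_nat n * divisor_sum 3 n"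
    by (simp add: simps)

  define h3 where "h3 = (\<lambda>a b :: complex. (a ^ 2 + a * b + b ^ 2) ^ 3)"
  have 3: "(\<Sum>a<d. h3 (of_nat a) (of_nat d - of_nat a)) =
      83 / 140 * of_nat d ^ 7 + 1 / 2 * of_nat d ^ 5 + (- 7 / 60) * of_nat d ^ 3 + 1 / 42 * of_nat d ^ 1" for d
  proof -
    define D where "D = (of_nat d :: complex)"
    have *: "h3 a (D - a) = D ^ 6 * 1 - (3 * D ^ 5) * a + (6 * D ^ 4) * a ^ 2 - (7 * D ^ 3) * a ^ 3
                         + (6 * D ^ 2) * a ^ 4 - (3 * D) * a ^ 5 + a ^ 6" for a
      unfolding h3_def by algebra
    show ?thesis unfolding D_def [symmetric]
      by (simp only: * sums) (simp add: D_def [symmetric] field_simps power_numeral_reduce)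
  qed
  have "(\<Sum>(a, b, x, y)\<in>quads n. h3 (of_nat a) (of_nat b) - h3 (of_nat a) (of_nat b - of_nat a)) =
      83 / 140 * divisor_sum 7 n + 1 / 2 * divisor_sum 5 n + (- 7 / 60) * divisor_sum 3 n + 1 / 42 * divisor_sum 1 n
        
        - 1 * (of_nat n * divisor_sum 5 n)"
    by (rule sum_quads_telescope_sigma[OF _ _ n _ 3]) (auto simp: h3_def; algebra)+
  moreover have "h3 a b - h3 a (b - a) = 6 * (a ^ 1 * b ^ 5) + 6 * (a ^ 5 * b ^ 1) + 14 * (a ^ 3 * b ^ 3)" for a b
    unfolding h3_def by algebra
  moreover have "12 * sigma_conv 1 5 n = 6 * sigma_conv 1 5 n + 6 * sigma_conv 5 1 n"
    using swap[of 1 5] by simp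
  ultimately show "12 * sigma_conv 1 5 n + 14 * sigma_conv 3 3 n =
      83 / 140 * divisor_sum 7 n + 1 / 2 * divisor_sum 5 n - 7 / 60 * divisor_sum 3 n + 1 / 42 * divisor_sum 1 n
        - of_nat n * divisor_sum 5 n"
    by (simp add: simps)

  \<comment> \<open>\<open>h3\<close> leaves two convolutions, of orders (1, 5) and (3, 3), in one
    equation; a second polynomial of degree 6 isolates the latter. It vanishes at
    \<open>b = 0\<close>, so no term with the factor \<open>n\<close> arises.\<close>
  define h4 where "h4 = (\<lambda>a b :: complex. (a * b * (a + b)) ^ 2)"
  have 4: "(\<Sum>a<d. h4 (of_nat a) (of_nat d - of_nat a)) =
      1 / 30 * of_nat d ^ 7 + 0 * of_nat d ^ 5 + (- 1 / 30) * of_nat d ^ 3 + 0 * of_nat d ^ 1" for d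
  proof -
    define D where "D = (of_nat d :: complex)"
    have *: "h4 a (D - a) = D ^ 4 * a ^ 2 - (2 * D ^ 3) * a ^ 3 + D ^ 2 * a ^ 4" for a
      unfolding h4_def by algebra
    show ?thesis unfolding D_def [symmetric]
      by (simp only: * sums) (simp add: D_def [symmetric] field_simps power_numeral_reduce)
  qed
  have "(\<Sum>(a, b, x, y)\<in>quads n. h4 (of_nat a) (of_nat b) - h4 (of_nat a) (of_nat b - of_nat a)) =
      1 / 30 * divisor_sum 7 n + 0 * divisor_sum 5 n + (- 1 / 30) * divisor_sum 3 n + 0 * divisor_sum 1 n - 0 * (of_nat n * divisor_sum 0 n)"
    by (rule sum_quads_telescope_sigma[OF _ _ n _ 4]) (auto simp: h4_def; algebra)+
  moreover have "h4 a b - h4 a (b - a) = 4 * (a ^ 3 * b ^ 3)" for a b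
    unfolding h4_def by algebra
  ultimately show "4 * sigma_conv 3 3 n = 1 / 30 * divisor_sum 7 n - 1 / 30 * divisor_sum 3 n"
    by (simp add: simps)
qed

section \<open>Ramanujan's differential equations\<close>

definition sigma_fps :: "nat \<Rightarrow> complex fps" where
  "sigma_fps k = Abs_fps (divisor_sum k)"

text \<open>This is \<open>D = q d/dq\<close>. Under \<open>q = nome z\<close> it is the derivative
  in \<open>z\<close> divided by \<open>2 pi i\<close>.\<close>

definition theta :: "complex fps \<Rightarrow> complex fps" where
  "theta f = fps_X * fps_deriv f"

lemma fps_nth_theta [simp]: "fps_nth (theta f) n = of_nat n * fps_nth f n"
  by (cases n) (simp_all add: theta_def)

lemma theta_add: "theta (f + g) = theta f + theta g"
  and theta_diff: "theta (f - g) = theta f - theta g"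
  and theta_mult: "theta (f * g) = theta f * g + f * theta g"
  and theta_numeral_mult: "theta (numeral c * f) = numeral c * theta f"
  and theta_power: "theta (f ^ m) = of_nat m * theta f * f ^ (m - 1)"
  and theta_1 [simp]: "theta 1 = 0"
  and theta_X [simp]: "theta fps_X = fps_X"
  by (simp_all add: theta_def algebra_simps fps_deriv_power flip: fps_of_nat)

text \<open>The Eisenstein series are treated as formal series in \<open>q\<close>, so that
  differential identities between them reduce to identities of coefficients.\<close>

definition e2 :: "complex fps" where "e2 = 1 - 24 * sigma_fps 1"
definition e4 :: "complex fps" where "e4 = 1 + 240 * sigma_fps 3"
definition e6 :: "complex fps" where "e6 = 1 - 504 * sigma_fps 5"

lemma fps_nth_sigma_fps [simp]: "fps_nth (sigma_fps k) n = divisor_sum k n"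
  by (simp add: sigma_fps_def)

lemma fps_nth_sigma_fps_mult: "fps_nth (sigma_fps j * sigma_fps k) n = sigma_conv j k n"
  by (simp add: fps_mult_nth sigma_conv_def atLeast0AtMost)

lemma
  shows sigma_fps_1_1: "12 * (sigma_fps 1 * sigma_fps 1) =
      5 * sigma_fps 3 + sigma_fps 1 - 6 * theta (sigma_fps 1)"
    and sigma_fps_1_3: "240 * (sigma_fps 1 * sigma_fps 3) =
      21 * sigma_fps 5 + 10 * sigma_fps 3 - sigma_fps 1 - 30 * theta (sigma_fps 3)"
    and sigma_fps_3_3: "120 * (sigma_fps 3 * sigma_fps 3) = sigma_fps 7 - sigma_fps 3"
    and sigma_fps_1_5: "504 * (sigma_fps 1 * sigma_fps 5) =
      20 * sigma_fps 7 + 21 * sigma_fps 5 + sigma_fps 1 - 42 * theta (sigma_fps 5)"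
proof -
  have conv0: "sigma_conv j k 0 = 0" for j k by (simp add: sigma_conv_def)
  show "12 * (sigma_fps 1 * sigma_fps 1) = 5 * sigma_fps 3 + sigma_fps 1 - 6 * theta (sigma_fps 1)"
  proof (rule fps_ext)
    fix n show "fps_nth (12 * (sigma_fps 1 * sigma_fps 1)) n =
      fps_nth (5 * sigma_fps 3 + sigma_fps 1 - 6 * theta (sigma_fps 1)) n"
    proof (cases "n = 0")
      case False
      hence n: "n > 0" by simp
      have "12 * sigma_conv 1 1 n = 6 * (2 * sigma_conv 1 1 n)"
        by simp
      also have "\<dots> = 5 * divisor_sum 3 n + divisor_sum 1 n - 6 * (of_nat n * divisor_sum 1 n)"
        unfolding sigma_conv_1_1[OF n] by (simp add: algebra_simps)
      finally show ?thesis by (simp add: fps_nth_sigma_fps_mult)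
    qed (simp add: fps_nth_sigma_fps_mult conv0)
  qed
  show "240 * (sigma_fps 1 * sigma_fps 3) = 21 * sigma_fps 5 + 10 * sigma_fps 3 - sigma_fps 1 - 30 * theta (sigma_fps 3)"
  proof (rule fps_ext)
    fix n show "fps_nth (240 * (sigma_fps 1 * sigma_fps 3)) n =
      fps_nth (21 * sigma_fps 5 + 10 * sigma_fps 3 - sigma_fps 1 - 30 * theta (sigma_fps 3)) n"
    proof (cases "n = 0")
      case False
      hence n: "n > 0" by simp
      have "240 * sigma_conv 1 3 n = 30 * (8 * sigma_conv 1 3 n)"
        by simp
      also have "\<dots> = 21 * divisor_sum 5 n + 10 * divisor_sum 3 n - divisor_sum 1 n - 30 * (of_nat n * divisor_sum 3 n)"
        unfolding sigma_conv_1_3[OF n] by (simp add: algebra_simps)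
      finally show ?thesis by (simp add: fps_nth_sigma_fps_mult)
    qed (simp add: fps_nth_sigma_fps_mult conv0)
  qed
  show "120 * (sigma_fps 3 * sigma_fps 3) = sigma_fps 7 - sigma_fps 3"
  proof (rule fps_ext)
    fix n show "fps_nth (120 * (sigma_fps 3 * sigma_fps 3)) n =
      fps_nth (sigma_fps 7 - sigma_fps 3) n"
    proof (cases "n = 0")
      case False
      hence n: "n > 0" by simp
      have "120 * sigma_conv 3 3 n = 30 * (4 * sigma_conv 3 3 n)"
        by simp
      also have "\<dots> = divisor_sum 7 n - divisor_sum 3 n"
        unfolding sigma_conv_3_3[OF n] by (simp add: algebra_simps)
      finally show ?thesis by (simp add: fps_nth_sigma_fps_mult)
    qed (simp add: fps_nth_sigma_fps_mult conv0)
  qed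
  show "504 * (sigma_fps 1 * sigma_fps 5) =
      20 * sigma_fps 7 + 21 * sigma_fps 5 + sigma_fps 1 - 42 * theta (sigma_fps 5)"
  proof (rule fps_ext)
    fix n show "fps_nth (504 * (sigma_fps 1 * sigma_fps 5)) n =
      fps_nth (20 * sigma_fps 7 + 21 * sigma_fps 5 + sigma_fps 1 - 42 * theta (sigma_fps 5)) n"
    proof (cases "n = 0")
      case False
      hence n: "n > 0" by simp
      \<comment> \<open>The multipliers eliminate \<open>sigma_conv 3 3\<close>, because 42 * 14 =
        147 * 4.\<close>
      have "504 * sigma_conv 1 5 n = 42 * (12 * sigma_conv 1 5 n + 14 * sigma_conv 3 3 n) - 147 * (4 * sigma_conv 3 3 n)"
        by simp
      also have "\<dots> = 20 * divisor_sum 7 n + 21 * divisor_sum 5 n + divisor_sum 1 n - 42 * (of_nat n * divisor_sum 5 n)"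
        unfolding sigma_conv_1_5_3_3[OF n] sigma_conv_3_3[OF n] by (simp add: algebra_simps)
      finally show ?thesis by (simp add: fps_nth_sigma_fps_mult)
    qed (simp add: fps_nth_sigma_fps_mult conv0)
  qed
qed

text \<open>After expansion each product of divisor series is replaced by its linear expression. In
  the last equation the \<open>sigma_fps 7\<close> terms of \<open>e2 * e6\<close> and
  \<open>e4 ^ 2\<close> cancel.\<close>

lemma ramanujan:
  shows ramanujan_e2: "12 * theta e2 = e2 ^ 2 - e4"
    and ramanujan_e4: "3 * theta e4 = e2 * e4 - e6"
    and ramanujan_e6: "2 * theta e6 = e2 * e6 - e4 ^ 2"
proof -
  note th = theta_add theta_diff theta_numeral_mult theta_1
  have "e2 ^ 2 - e4 = 48 * (12 * (sigma_fps 1 * sigma_fps 1)) - 48 * sigma_fps 1 - 240 * sigma_fps 3"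
    unfolding e2_def e4_def by (simp add: algebra_simps power2_eq_square)
  also have "\<dots> = 12 * theta e2"
    unfolding sigma_fps_1_1 e2_def th by (simp add: algebra_simps)
  finally show "12 * theta e2 = e2 ^ 2 - e4" ..
  have "e2 * e4 - e6 = 240 * sigma_fps 3 - 24 * sigma_fps 1 + 504 * sigma_fps 5
                       - 24 * (240 * (sigma_fps 1 * sigma_fps 3))"
    unfolding e2_def e4_def e6_def by (simp add: algebra_simps)
  also have "\<dots> = 3 * theta e4"
    unfolding sigma_fps_1_3 e4_def th by (simp add: algebra_simps)
  finally show "3 * theta e4 = e2 * e4 - e6" ..
  have "e2 * e6 - e4 ^ 2 = 24 * (504 * (sigma_fps 1 * sigma_fps 5)) - 24 * sigma_fps 1
      - 504 * sigma_fps 5 - 480 * sigma_fps 3 - 480 * (120 * (sigma_fps 3 * sigma_fps 3))"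
    unfolding e2_def e4_def e6_def by (simp add: algebra_simps power2_eq_square)
  also have "\<dots> = 2 * theta e6"
    unfolding sigma_fps_1_5 sigma_fps_3_3 e6_def th by (simp add: algebra_simps)
  finally show "2 * theta e6 = e2 * e6 - e4 ^ 2" ..
qed

section \<open>The discriminant as a formal power series\<close>

definition delta :: "complex fps" where
  "delta = fps_const (1 / 1728) * (e4 ^ 3 - e6 ^ 2)"

lemma delta_1728: "1728 * delta = e4 ^ 3 - e6 ^ 2"
proof -
  have "1728 * delta = (1728 * fps_const (1 / 1728)) * (e4 ^ 3 - e6 ^ 2)"
    unfolding delta_def by (simp only: mult.assoc)
  also have "1728 * fps_const (1 / 1728) = (1 :: complex fps)"
    by (simp only: numeral_fps_const fps_const_mult) simp
  finally show ?thesis by simp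
qed

lemma fps_numeral_mult_cancel:
  assumes "numeral c * f = numeral c * (g :: complex fps)"
  shows "f = g"
proof (rule fps_ext)
  fix n show "fps_nth f n = fps_nth g n"
    using arg_cong[OF assms, of "\<lambda>h. fps_nth h n"] by simp
qed

text \<open>The mixed terms \<open>e4 ^ 2 * e6\<close> coming from the two Ramanujan equations
  cancel. The eta product will be shown to satisfy the same first-order equation.\<close>

lemma theta_delta: "theta delta = e2 * delta"
proof -
  have "1728 * theta delta = theta (e4 ^ 3 - e6 ^ 2)"
    by (simp only: delta_1728 theta_numeral_mult [symmetric])
  also have "\<dots> = 3 * theta e4 * e4 ^ 2 - 2 * theta e6 * e6"
    by (simp add: theta_diff theta_power)
  also have "\<dots> = e2 * (e4 ^ 3 - e6 ^ 2)"
    unfolding ramanujan by (simp add: algebra_simps power2_eq_square power3_eq_cube)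
  also have "\<dots> = 1728 * (e2 * delta)"
    by (simp only: delta_1728 [symmetric] mult.left_commute)
  finally show ?thesis by (rule fps_numeral_mult_cancel)
qed

text \<open>The right-hand side is, up to scale, the second Rankin-Cohen bracket of
  \<open>e4\<close> with itself. Through it the weight of \<open>delta\<close> is deduced from that
  of \<open>e4\<close>.\<close>

lemma delta_bracket: "960 * delta = 4 * e4 * theta (theta e4) - 5 * theta e4 ^ 2"
proof -
  have *: "3 * theta (theta e4) = theta e2 * e4 + e2 * theta e4 - theta e6"
    unfolding theta_numeral_mult [of _ "theta e4", symmetric] ramanujan_e4 theta_diff theta_mult ..
  \<comment> \<open>With the factor 36 every derivative occurs with the coefficient that it carries
    in \<open>ramanujan\<close>.\<close>
  have "36 * (4 * e4 * theta (theta e4) - 5 * theta e4 ^ 2) =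
        48 * e4 * (3 * theta (theta e4)) - 20 * (3 * theta e4) ^ 2"
    by (simp add: algebra_simps power2_eq_square)
  also have "\<dots> = 4 * e4 ^ 2 * (12 * theta e2) + 16 * e2 * e4 * (3 * theta e4)
                    - 24 * e4 * (2 * theta e6) - 20 * (3 * theta e4) ^ 2"
    unfolding * by (simp add: algebra_simps power2_eq_square)
  also have "\<dots> = 20 * (e4 ^ 3 - e6 ^ 2)"
    unfolding ramanujan by (simp add: algebra_simps power2_eq_square power3_eq_cube)
  also have "\<dots> = (20 * 1728) * delta"
    by (simp only: delta_1728 [symmetric] mult.assoc)
  also have "\<dots> = (36 * 960) * delta" by simp
  also have "\<dots> = 36 * (960 * delta)" by (simp only: mult.assoc)
  finally show ?thesis by (rule fps_numeral_mult_cancel [OF sym])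
qed

definition delta_unit :: "complex fps" where
  "delta_unit = fps_shift 1 delta"

lemma sigma_Suc_0 [simp]: "divisor_sum k (Suc 0) = 1"
  by (simp add: divisor_sum_def)

lemma delta_eq: "delta = fps_X * delta_unit" 
  and delta_unit_0: "fps_nth delta_unit 0 = 1"
proof -
  have "fps_nth (e4 ^ 3) 0 = 1" "fps_nth (e6 ^ 2) 0 = 1"
    by (simp_all add: e4_def e6_def fps_power_zeroth)
  hence "fps_nth delta 0 = 0" by (simp add: delta_def)
  thus *: "delta = fps_X * delta_unit"
    by (intro fps_ext) (simp add: delta_unit_def)
  have "fps_nth (e4 ^ 3) 1 = 720" "fps_nth (e6 ^ 2) 1 = - 1008"
    by (simp_all add: e4_def e6_def power_numeral_reduce fps_mult_nth_1)
  thus "fps_nth delta_unit 0 = 1"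
    by (simp add: delta_unit_def delta_def)
qed

lemma theta_delta_unit: "theta delta_unit = (e2 - 1) * delta_unit"
proof -
  have "fps_X * (delta_unit + theta delta_unit) = fps_X * (e2 * delta_unit)"
    using theta_delta unfolding delta_eq theta_mult theta_X by (simp add: algebra_simps)
  hence "delta_unit + theta delta_unit = e2 * delta_unit" by simp
  thus ?thesis by (simp add: algebra_simps)
qed

text \<open>The double series of \<open>m ^ k * q ^ (m * l)\<close> converges absolutely. Summed
  over \<open>l\<close> first it is the Lambert series; regrouped by \<open>n = m * l\<close> it is
  the power series of the divisor sums.\<close>

lemma
  fixes q :: complex
  assumes "norm q < 1"
  shows lambert_sigma: "(\<Sum>m. of_nat (Suc m) ^ k * q ^ Suc m / (1 - q ^ Suc m)) = eval_fps (sigma_fps k) q"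
    and summable_sigma: "summable (\<lambda>n. divisor_sum k n * q ^ n)"
proof -
  define f where "f = (\<lambda>(m, l). of_nat m ^ k * q ^ (m * l) :: complex)"
  define A where "A = {1::nat..}"
  have geom: "((\<lambda>l. c * r ^ (m * l)) has_sum (c * r ^ m / (1 - r ^ m))) A"
    if "norm r < 1" "m \<in> A" for c r :: "'a :: {real_normed_field, banach}" and m
  proof -
    have r: "norm (r ^ m) < 1" using that by (auto simp: norm_power A_def power_less_one_iff)
    from has_sum_cmult_right[OF has_sum_geometric_from_1[OF this], of c]
    show ?thesis by (simp add: power_mult A_def)
  qed
  have norm_geom: "(\<lambda>l. norm (f (m, l))) = (\<lambda>l. real m ^ k * norm q ^ (m * l))" for m
    by (simp add: f_def norm_mult norm_power)
  have summable_norm: "summable (\<lambda>m. norm (of_nat m ^ k * q ^ m))"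
  proof -
    have "conv_radius (\<lambda>n. of_nat n ^ k :: complex) = 1"
    proof (rule conv_radius_ratio_limit_nonzero[of _ 1])
      have "(\<lambda>n. (real n / real (Suc n)) ^ k) \<longlonglongrightarrow> 1 ^ k"
        by (intro tendsto_power LIMSEQ_n_over_Suc_n)
      thus "(\<lambda>n. norm (of_nat n ^ k :: complex) / norm (of_nat (Suc n) ^ k :: complex)) \<longlonglongrightarrow> 1"
        by (simp add: norm_power power_divide del: of_nat_Suc)
    qed (auto simp: one_ereal_def)
    thus ?thesis by (intro abs_summable_in_conv_radius) (use assms in auto)
  qed
  have abs: "(\<lambda>p. norm (f p)) summable_on A \<times> A"
  proof (rule Infinite_Sum.abs_summable_on_Sigma_iff [THEN iffD2], intro conjI ballI)
    fix m assume m: "m \<in> A"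
    show "(\<lambda>l. norm (f (m, l))) summable_on A"
      unfolding norm_geom using geom[of "norm q" m "real m ^ k"] m assms
      by (auto intro: has_sum_imp_summable)
  next
    have "norm (infsum (\<lambda>l. norm (f (m, l))) A) \<le> norm (of_nat m ^ k * q ^ m) / (1 - norm q)"
      if m: "m \<in> A" for m
    proof -
      have "infsum (\<lambda>l. norm (f (m, l))) A = real m ^ k * norm q ^ m / (1 - norm q ^ m)"
        unfolding norm_geom using geom[of "norm q" m "real m ^ k"] m assms
        by (intro infsumI) auto
      moreover have "norm q ^ m \<le> norm q"
        using m assms power_decreasing[of 1 m "norm q"] by (auto simp: A_def)
      ultimately show ?thesis using assms
        by (auto simp: norm_mult norm_power intro!: divide_left_mono mult_pos_pos)
    qed
    moreover have "(\<lambda>m. norm (of_nat m ^ k * q ^ m) / (1 - norm q)) summable_on A"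
      unfolding divide_inverse using summable_norm
      by (intro summable_on_cmult_left summable_on_subset_banach[of _ UNIV A] norm_summable_imp_summable_on) auto
    ultimately show "(\<lambda>m. norm (infsum (\<lambda>l. norm (f (m, l))) A)) summable_on A"
      by (intro Infinite_Sum.abs_summable_on_comparison_test'[where g = "\<lambda>m. norm (of_nat m ^ k * q ^ m) / (1 - norm q)"]) auto
  qed
  have "f summable_on A \<times> A" by (rule abs_summable_summable [OF abs])
  then obtain I where I: "(f has_sum I) (A \<times> A)" by (auto simp: summable_on_def)
  have "((\<lambda>m. of_nat m ^ k * q ^ m / (1 - q ^ m)) has_sum I) A"
    by (rule has_sum_SigmaD[OF I]) (use geom[OF assms] in \<open>auto simp: f_def\<close>)
  hence "((\<lambda>m. of_nat (Suc m) ^ k * q ^ Suc m / (1 - q ^ Suc m)) has_sum I) UNIV"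
    by (subst (asm) has_sum_reindex_bij_witness[of _ Suc "\<lambda>m. m - 1" UNIV]) (auto simp: A_def simp flip: power_Suc)
  from has_sum_imp_sums[OF this] have 1: "(\<lambda>m. of_nat (Suc m) ^ k * q ^ Suc m / (1 - q ^ Suc m)) sums I" .
  have "((\<lambda>(n, d). of_nat d ^ k * q ^ n) has_sum I) (SIGMA n:A. {d. d dvd n})"
    using I
    by (subst (asm) has_sum_reindex_bij_witness[of _ "\<lambda>(n, d). (d, n div d)" "\<lambda>(m, l). (m * l, m)"
          "SIGMA n:A. {d. d dvd n}"])
       (auto simp: A_def f_def Suc_le_eq intro!: Nat.gr0I)
  hence "((\<lambda>n. divisor_sum k n * q ^ n) has_sum I) A"
  proof (rule has_sum_SigmaD)
    fix n assume "n \<in> A"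
    thus "((\<lambda>d. case (n, d) of (n, d) \<Rightarrow> of_nat d ^ k * q ^ n) has_sum divisor_sum k n * q ^ n) {d. d dvd n}"
      by (intro has_sum_finiteI) (auto simp: A_def divisor_sum_def sum_distrib_right)
  qed
  hence "((\<lambda>n. divisor_sum k n * q ^ n) has_sum I) UNIV"
    by (rule has_sum_cong_neutral [THEN iffD1, rotated -1]) (auto simp: A_def not_le)
  from has_sum_imp_sums[OF this] have 2: "(\<lambda>n. divisor_sum k n * q ^ n) sums I" .
  show "summable (\<lambda>n. divisor_sum k n * q ^ n)" using 2 by (rule sums_summable)
  show "(\<Sum>m. of_nat (Suc m) ^ k * q ^ Suc m / (1 - q ^ Suc m)) = eval_fps (sigma_fps k) q"
    using 1 2 by (simp add: eval_fps_def sums_iff)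
qed

lemma fps_conv_radius_sigma_fps: "fps_conv_radius (sigma_fps k) \<ge> 1"
  unfolding fps_conv_radius_def
proof (rule conv_radius_geI_ex')
  fix r :: real assume "0 < r" "ereal r < 1"
  thus "summable (\<lambda>n. fps_nth (sigma_fps k) n * of_real r ^ n)"
    using summable_sigma[of "of_real r" k] by simp
qed

section \<open>Power series converging on the unit disc\<close>

definition disc_fps :: "complex fps \<Rightarrow> bool" where
  "disc_fps f \<longleftrightarrow> 1 \<le> fps_conv_radius f"

named_theorems disc_fps_intros

lemma disc_fps_add [disc_fps_intros]: "disc_fps f \<Longrightarrow> disc_fps g \<Longrightarrow> disc_fps (f + g)"
  unfolding disc_fps_def by (rule order.trans[OF _ fps_conv_radius_add]) simp

lemma disc_fps_diff [disc_fps_intros]: "disc_fps f \<Longrightarrow> disc_fps g \<Longrightarrow> disc_fps (f - g)"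
  unfolding disc_fps_def by (rule order.trans[OF _ fps_conv_radius_diff]) simp

lemma disc_fps_mult [disc_fps_intros]: "disc_fps f \<Longrightarrow> disc_fps g \<Longrightarrow> disc_fps (f * g)"
  unfolding disc_fps_def by (rule order.trans[OF _ fps_conv_radius_mult]) simp

lemma disc_fps_power [disc_fps_intros]: "disc_fps f \<Longrightarrow> disc_fps (f ^ m)"
  unfolding disc_fps_def by (rule order.trans[OF _ fps_conv_radius_power])

lemma disc_fps_basic [disc_fps_intros, simp]:
  "disc_fps 0" "disc_fps 1" "disc_fps (numeral k)" "disc_fps (fps_const c)" "disc_fps fps_X"
  by (simp_all add: disc_fps_def)

lemma disc_fps_theta [disc_fps_intros]: "disc_fps f \<Longrightarrow> disc_fps (theta f)"
  unfolding theta_def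
  by (intro disc_fps_intros) (auto simp: disc_fps_def intro: order.trans[OF _ fps_conv_radius_deriv])

lemma disc_fps_sigma_fps [disc_fps_intros]: "disc_fps (sigma_fps k)"
  using fps_conv_radius_sigma_fps by (simp add: disc_fps_def)

lemma disc_fps_eisenstein [disc_fps_intros]: "disc_fps e2" "disc_fps e4" "disc_fps e6" "disc_fps delta"
  by (auto simp: e2_def e4_def e6_def delta_def intro!: disc_fps_intros)

lemma disc_fps_sum [disc_fps_intros]: "(\<And>i. i \<in> I \<Longrightarrow> disc_fps (f i)) \<Longrightarrow> disc_fps (sum f I)"
  by (induction I rule: infinite_finite_induct) (auto intro: disc_fps_intros)

lemma disc_fps_norm_less: "disc_fps f \<Longrightarrow> norm q < 1 \<Longrightarrow> ereal (norm q) < fps_conv_radius f"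
  unfolding disc_fps_def by (metis ereal_less(3) less_le_trans)

lemma eval_disc_fps:
  assumes "norm q < 1"
  shows "disc_fps f \<Longrightarrow> disc_fps g \<Longrightarrow> eval_fps (f + g) q = eval_fps f q + eval_fps g q"
    and "disc_fps f \<Longrightarrow> disc_fps g \<Longrightarrow> eval_fps (f - g) q = eval_fps f q - eval_fps g q"
    and "disc_fps f \<Longrightarrow> disc_fps g \<Longrightarrow> eval_fps (f * g) q = eval_fps f q * eval_fps g q"
    and "disc_fps f \<Longrightarrow> eval_fps (f ^ m) q = eval_fps f q ^ m"
    and "disc_fps f \<Longrightarrow> eval_fps (theta f) q = q * deriv (eval_fps f) q"
proof -
  note n = disc_fps_norm_less[OF _ assms]
  show "disc_fps f \<Longrightarrow> disc_fps g \<Longrightarrow> eval_fps (f + g) q = eval_fps f q + eval_fps g q"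
    "disc_fps f \<Longrightarrow> disc_fps g \<Longrightarrow> eval_fps (f - g) q = eval_fps f q - eval_fps g q"
    "disc_fps f \<Longrightarrow> disc_fps g \<Longrightarrow> eval_fps (f * g) q = eval_fps f q * eval_fps g q"
    "disc_fps f \<Longrightarrow> eval_fps (f ^ m) q = eval_fps f q ^ m"
    by (simp_all add: eval_fps_add eval_fps_diff eval_fps_mult eval_fps_power n)
  show "disc_fps f \<Longrightarrow> eval_fps (theta f) q = q * deriv (eval_fps f) q"
    unfolding theta_def
    by (subst eval_fps_mult) (auto simp: eval_fps_deriv n intro: less_le_trans[OF n fps_conv_radius_deriv])
qed

lemma disc_fps_eqI:
  assumes "disc_fps f" "disc_fps g" 
    and eq: "\<And>q. norm q < 1 \<Longrightarrow> q \<noteq> 0 \<Longrightarrow> eval_fps f q = eval_fps g q"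
  shows "f = g"
proof -
  have pos: "fps_conv_radius (fps_X * h) > 0" if "disc_fps h" for h
  proof -
    have "disc_fps (fps_X * h)" using that by (intro disc_fps_intros)
    thus ?thesis unfolding disc_fps_def by (rule less_le_trans[rotated]) simp
  qed
  \<comment> \<open>Equality is assumed only off 0, since the nome omits that value; multiplication
    by \<open>fps_X\<close> makes both sides agree there as well.\<close>
  have "fps_X * f = fps_X * g"
  proof (rule eval_fps_eqD)
    have "eventually (\<lambda>q. q \<in> ball 0 1) (nhds (0 :: complex))"
      by (rule eventually_nhds_in_open) auto
    thus "eventually (\<lambda>q. eval_fps (fps_X * f) q = eval_fps (fps_X * g) q) (nhds 0)"
    proof eventually_elim
      case (elim q)
      thus ?case using eq[of q] assms by (cases "q = 0") (simp_all add: eval_disc_fps)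
    qed
  qed (use pos assms in auto)
  thus ?thesis by simp
qed

section \<open>The Euler product and the product formula for the discriminant\<close>

definition euler_prod :: "complex \<Rightarrow> complex" where
  "euler_prod q = (\<Prod>m. 1 - q ^ Suc m)"

lemma convergent_euler_prod:
  assumes "norm (q :: complex) < 1"
  shows "convergent_prod (\<lambda>m. 1 - q ^ Suc m)"
  using assms
  by (intro abs_convergent_prod_imp_convergent_prod summable_imp_abs_convergent_prod)
     (simp add: norm_mult norm_power summable_mult)

lemma one_minus_power_nonzero: 
  assumes "norm (q :: complex) < 1"
  shows "1 - q ^ Suc m \<noteq> 0"
proof -
  have "norm q ^ Suc m < 1" using power_decreasing[of 1 "Suc m" "norm q"] assms by auto
  hence "norm (q ^ Suc m) \<noteq> norm (1 :: complex)" unfolding norm_power by simp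
  thus ?thesis by (metis eq_iff_diff_eq_0)
qed

lemma euler_prod_nonzero: "norm q < 1 \<Longrightarrow> euler_prod q \<noteq> 0"
  unfolding euler_prod_def
  by (intro prodinf_nonzero convergent_euler_prod one_minus_power_nonzero)

text \<open>The Weierstrass test applies with majorant \<open>r ^ Suc n\<close>. Uniformity gives
  both holomorphy of the product and its termwise logarithmic derivative.\<close>

lemma uniform_limit_euler_prod:
  assumes "r < 1"
  shows "uniform_limit (cball 0 r) (\<lambda>n q. \<Prod>k<n. 1 - q ^ Suc k) euler_prod sequentially"
proof -
  have "uniformly_convergent_on (cball 0 r) (\<lambda>n q. \<Prod>k<n. 1 - q ^ Suc k :: complex)"
  proof (cases "r \<ge> 0")
    case True
    show ?thesis
    proof (rule uniformly_convergent_on_prod')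
      show "uniformly_convergent_on (cball 0 r) (\<lambda>N q. \<Sum>n<N. norm (1 - q ^ Suc n - 1 :: complex))"
      proof (rule Weierstrass_m_test')
        show "summable (\<lambda>n. r ^ Suc n)" using assms True by (simp add: summable_mult)
      next
        fix n and q :: complex assume "q \<in> cball 0 r"
        thus "norm (norm (1 - q ^ Suc n - 1)) \<le> r ^ Suc n"
          using power_mono[of "norm q" r "Suc n"] by (simp add: norm_power norm_mult)
      qed
    qed (auto intro!: continuous_intros)
  qed auto
  hence "uniform_limit (cball 0 r) (\<lambda>n q. \<Prod>k<n. 1 - q ^ Suc k)
           (\<lambda>q. lim (\<lambda>n. \<Prod>k<n. 1 - q ^ Suc k :: complex)) sequentially"
    by (simp only: uniformly_convergent_uniform_limit_iff)
  also have "?this \<longleftrightarrow> ?thesis"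
  proof (rule uniform_limit_cong')
    fix q :: complex assume "q \<in> cball 0 r"
    hence q: "norm q < 1" using assms by auto
    show "lim (\<lambda>n. \<Prod>k<n. 1 - q ^ Suc k) = euler_prod q"
      unfolding euler_prod_def
      by (rule prodinf_eq_lim' [OF convergent_euler_prod one_minus_power_nonzero, symmetric]) fact+
  qed auto
  finally show ?thesis .
qed

lemma euler_prod_holomorphic: "euler_prod holomorphic_on ball 0 1"
proof (rule holomorphic_uniform_sequence)
  fix x :: complex assume "x \<in> ball 0 1"
  hence x: "norm x < 1" by simp
  define d where "d = (1 - norm x) / 2"
  have sub: "cball x d \<subseteq> cball 0 (norm x + d)"
  proof
    fix y assume "y \<in> cball x d"
    thus "y \<in> cball 0 (norm x + d)"
      using norm_triangle_ineq[of x "y - x"] by (simp add: dist_norm norm_minus_commute)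
  qed
  have "uniform_limit (cball x d) (\<lambda>n q. \<Prod>k<n. 1 - q ^ Suc k) euler_prod sequentially"
    by (rule uniform_limit_on_subset[OF uniform_limit_euler_prod sub]) (use x in \<open>simp add: d_def field_simps\<close>)
  moreover have "cball x d \<subseteq> ball 0 1"
    using sub x by (fastforce simp: d_def field_simps)
  ultimately show "\<exists>d. 0 < d \<and> cball x d \<subseteq> ball 0 1 \<and>
      uniform_limit (cball x d) (\<lambda>n q. \<Prod>k<n. 1 - q ^ Suc k) euler_prod sequentially"
    using x by (intro exI[of _ d]) (auto simp: d_def)
qed (auto intro!: holomorphic_intros)

text \<open>The termwise logarithmic derivative, multiplied by \<open>- q\<close>, is the Lambert
  series of \<open>sigma_fps 1\<close>.\<close>

lemma deriv_euler_prod: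
  assumes q: "norm q < 1"
  shows "q * deriv euler_prod q = - eval_fps (sigma_fps 1) q * euler_prod q"
proof -
  obtain r where r: "norm q < r" "r < 1" using dense[OF q] by blast
  have deriv: "deriv (\<lambda>q. 1 - q ^ Suc k) q = - of_nat (Suc k) * q ^ k" for k and q :: complex
    using DERIV_diff[OF DERIV_const[of 1 "at q"] DERIV_power[OF DERIV_ident[of "at q"], of "Suc k"]]
    by (intro DERIV_imp_deriv) (simp add: algebra_simps)
  have "(\<lambda>k. deriv (\<lambda>q. 1 - q ^ Suc k) q / (1 - q ^ Suc k)) sums (deriv euler_prod q / euler_prod q)"
  proof (rule logderiv_prodinf_complex_uniform_limit[where A = "ball 0 r"])
    show "uniform_limit (ball 0 r) (\<lambda>n x. \<Prod>k<n. 1 - x ^ Suc k) euler_prod sequentially"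
      by (rule uniform_limit_on_subset[OF uniform_limit_euler_prod[OF r(2)]]) auto
  qed (use r q euler_prod_nonzero in \<open>auto intro!: holomorphic_intros\<close>)
  hence "(\<lambda>k. - of_nat (Suc k) * q ^ k / (1 - q ^ Suc k)) sums (deriv euler_prod q / euler_prod q)"
    by (simp only: deriv)
  hence "(\<lambda>k. - q * (- of_nat (Suc k) * q ^ k / (1 - q ^ Suc k))) sums
          (- q * (deriv euler_prod q / euler_prod q))"
    by (rule sums_mult)
  moreover have "- q * (- of_nat (Suc k) * q ^ k / (1 - q ^ Suc k)) =
      of_nat (Suc k) ^ 1 * q ^ Suc k / (1 - q ^ Suc k)" for k
    unfolding times_divide_eq_right
    by (rule arg_cong[of _ _ "\<lambda>x. x / (1 - q ^ Suc k)"]) (simp add: algebra_simps)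
  ultimately have "(\<lambda>k. of_nat (Suc k) ^ 1 * q ^ Suc k / (1 - q ^ Suc k)) sums
          (- q * (deriv euler_prod q / euler_prod q))"
    by simp
  from sums_unique[OF this] have "- q * (deriv euler_prod q / euler_prod q) = eval_fps (sigma_fps 1) q"
    unfolding lambert_sigma[OF q] .
  hence "- q * deriv euler_prod q = eval_fps (sigma_fps 1) q * euler_prod q"
    using euler_prod_nonzero[OF q] by (simp add: field_simps)
  thus ?thesis by (metis minus_mult_left minus_minus)
qed

text \<open>The expansion of \<open>q\<^sup>1\<^sup>/\<^sup>2 / \<eta>\<^sup>1\<^sup>2\<close>; working with this reciprocal avoids inverting power series.\<close>

definition eta_recip :: "complex fps" where
  "eta_recip = fps_expansion (\<lambda>q. inverse (euler_prod q ^ 12)) 0"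

lemma disc_fps_eta_recip [disc_fps_intros]: "disc_fps eta_recip"
  and eval_eta_recip: "norm q < 1 \<Longrightarrow> eval_fps eta_recip q = inverse (euler_prod q ^ 12)"
proof -
  have "(\<lambda>q. inverse (euler_prod q ^ 12)) holomorphic_on eball 0 1"
    unfolding one_ereal_def eball_ereal
    by (intro holomorphic_intros euler_prod_holomorphic) (auto dest: euler_prod_nonzero)
  from conv_radius_fps_expansion[OF this] eval_fps_expansion'[OF this]
  show "disc_fps eta_recip" "norm q < 1 \<Longrightarrow> eval_fps eta_recip q = inverse (euler_prod q ^ 12)"
    by (simp_all add: disc_fps_def eta_recip_def)
qed

lemma theta_eta_recip: "theta eta_recip = 12 * sigma_fps 1 * eta_recip"
proof (rule disc_fps_eqI)
  fix q :: complex assume q: "norm q < 1" "q \<noteq> 0"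
  have [derivative_intros]: "(euler_prod has_field_derivative deriv euler_prod q) (at q)"
    using q euler_prod_holomorphic by (intro holomorphic_derivI[of _ "ball 0 1"]) auto
  have "((\<lambda>q. inverse (euler_prod q ^ 12)) has_field_derivative
           (- 12 * deriv euler_prod q / euler_prod q * inverse (euler_prod q ^ 12))) (at q)"
    by (rule derivative_eq_intros refl)+
       (use euler_prod_nonzero[OF q(1)] in \<open>auto simp: field_simps power_numeral_reduce\<close>)
  moreover have "eventually (\<lambda>w. inverse (euler_prod w ^ 12) = eval_fps eta_recip w) (nhds q)"
    using eventually_nhds_in_open[of "ball 0 1" q] q by (auto elim!: eventually_mono simp: eval_eta_recip)
  ultimately have "(eval_fps eta_recip has_field_derivative
           (- 12 * deriv euler_prod q / euler_prod q * inverse (euler_prod q ^ 12))) (at q)"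
    by (subst (asm) DERIV_cong_ev[OF refl _ refl]) 
  hence "eval_fps (theta eta_recip) q =
         q * (- 12 * deriv euler_prod q / euler_prod q * inverse (euler_prod q ^ 12))"
    using q by (simp add: eval_disc_fps disc_fps_intros DERIV_imp_deriv)
  also have "\<dots> = - 12 * (q * deriv euler_prod q) / euler_prod q * inverse (euler_prod q ^ 12)"
    by simp
  also have "\<dots> = 12 * eval_fps (sigma_fps 1) q * inverse (euler_prod q ^ 12)"
    using euler_prod_nonzero[OF q(1)] by (simp add: deriv_euler_prod q)
  also have "\<dots> = eval_fps (12 * sigma_fps 1 * eta_recip) q"
    using q by (simp add: eval_disc_fps disc_fps_intros eval_eta_recip)
  finally show "eval_fps (theta eta_recip) q = eval_fps (12 * sigma_fps 1 * eta_recip) q" .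
qed (intro disc_fps_intros)+

lemma eta_recip_0: "fps_nth eta_recip 0 = 1"
  using eval_eta_recip[of 0] by (simp add: eval_fps_at_0 euler_prod_def)

text \<open>The logarithmic derivatives of the factors are \<open>- 24 * sigma_fps 1\<close> and
  \<open>2 * 12 * sigma_fps 1\<close>, so \<open>theta\<close> kills the product and only its
  constant term 1 remains. This is the identity between the discriminant and the 24th power of
  eta.\<close>

lemma delta_unit_eta_recip: "delta_unit * eta_recip ^ 2 = 1"
proof (rule fps_ext)
  fix n
  have "theta (delta_unit * eta_recip ^ 2) = 0"
    by (simp add: theta_mult theta_power theta_delta_unit theta_eta_recip e2_def algebra_simps power2_eq_square)
  from arg_cong[OF this, of "\<lambda>f. fps_nth f n"]
  show "fps_nth (delta_unit * eta_recip ^ 2) n = fps_nth 1 n"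
    by (cases "n = 0") (simp_all add: delta_unit_0 eta_recip_0 fps_power_zeroth)
qed

lemma delta_eta_recip: "delta * eta_recip ^ 2 = fps_X"
  by (simp add: delta_eq mult.assoc delta_unit_eta_recip)

section \<open>Functions on the upper half-plane\<close>

lemma open_upper_half_plane [simp, intro]: "open upper_half_plane"
  by (simp add: upper_half_plane_def open_halfspace_Im_gt)

lemma convex_upper_half_plane: "convex upper_half_plane"
  by (simp add: upper_half_plane_def convex_halfspace_Im_gt)

lemma connected_upper_half_plane: "connected upper_half_plane"
  by (rule convex_connected [OF convex_upper_half_plane])

lemma upper_half_plane_nonzero: "z \<in> upper_half_plane \<Longrightarrow> z \<noteq> 0"
  by (auto simp: upper_half_plane_def)

lemma minus_inverse_in_upper_half_plane:
  assumes "z \<in> upper_half_plane"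
  shows "- 1 / z \<in> upper_half_plane"
proof -
  have "Im (- 1 / z) = Im z / ((Re z)\<^sup>2 + (Im z)\<^sup>2)" by (simp add: Im_divide)
  moreover have "(Re z)\<^sup>2 + (Im z)\<^sup>2 > 0"
    using assms by (auto simp: upper_half_plane_def intro!: add_nonneg_pos)
  ultimately show ?thesis using assms by (auto simp: upper_half_plane_def)
qed

lemma norm_nome: "norm (nome z) = exp (- 2 * pi * Im z)"
  by (simp add: qpow_def)

lemma norm_nome_less_1: "z \<in> upper_half_plane \<Longrightarrow> norm (nome z) < 1"
  by (simp add: norm_nome upper_half_plane_def)

lemma qpow_nonzero [simp]: "qpow s z \<noteq> 0"
  by (simp add: qpow_def)

lemma qpow_add: "qpow (s + t) z = qpow s z * qpow t z"
  by (simp add: qpow_def algebra_simps flip: exp_add)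

lemma qpow_of_nat: "qpow (real m) z = nome z ^ m"
  by (simp add: qpow_def algebra_simps flip: exp_of_nat_mult)

lemma qpow_power: "qpow s z ^ m = qpow (real m * s) z"
  by (simp add: qpow_def algebra_simps flip: exp_of_nat_mult)

lemma qpow_has_field_derivative:
  "(qpow s has_field_derivative 2 * of_real pi * \<i> * of_real s * qpow s z) (at z within A)"
  unfolding qpow_def [abs_def] by (auto intro!: derivative_eq_intros)

lemma nome_add_1: "nome (z + 1) = nome z"
proof -
  have "nome (z + 1) = nome z * exp (2 * of_real pi * \<i>)"
    by (simp add: qpow_def ring_distribs exp_add)
  thus ?thesis by simp
qed

lemma nome_surj:
  assumes "norm q < 1" "q \<noteq> 0"
  obtains z where "z \<in> upper_half_plane" "nome z = q"
proof
  let ?z = "Ln q / (2 * of_real pi * \<i>)"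
  show "nome ?z = q" using assms by (simp add: qpow_def)
  have "Im ?z = - ln (norm q) / (2 * pi)"
    using assms by (simp add: Im_divide power2_eq_square field_simps)
  also have "\<dots> > 0" using assms by (auto intro!: divide_neg_pos simp: ln_less_zero_iff)
  finally show "?z \<in> upper_half_plane" by (simp add: upper_half_plane_def)
qed

definition q_eval :: "complex fps \<Rightarrow> complex \<Rightarrow> complex" where
  "q_eval f z = eval_fps f (nome z)"

lemma q_eval_simps:
  assumes "z \<in> upper_half_plane"
  shows "disc_fps f \<Longrightarrow> disc_fps g \<Longrightarrow> q_eval (f + g) z = q_eval f z + q_eval g z"
    and "disc_fps f \<Longrightarrow> disc_fps g \<Longrightarrow> q_eval (f - g) z = q_eval f z - q_eval g z"
    and "disc_fps f \<Longrightarrow> disc_fps g \<Longrightarrow> q_eval (f * g) z = q_eval f z * q_eval g z"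
    and "disc_fps f \<Longrightarrow> q_eval (f ^ m) z = q_eval f z ^ m"
  using eval_disc_fps[OF norm_nome_less_1[OF assms]] by (simp_all add: q_eval_def)

lemma q_eval_basic [simp]:
  "q_eval 0 z = 0" "q_eval 1 z = 1" "q_eval (numeral k) z = numeral k"
  "q_eval (fps_const c) z = c" "q_eval fps_X z = nome z"
  by (simp_all add: q_eval_def)

lemma q_eval_sum:
  assumes "z \<in> upper_half_plane" "\<And>i. i \<in> I \<Longrightarrow> disc_fps (f i)"
  shows "q_eval (sum f I) z = (\<Sum>i\<in>I. q_eval (f i) z)"
  using assms(2) by (induction I rule: infinite_finite_induct)
    (simp_all add: q_eval_simps assms(1) disc_fps_intros)

text \<open>The nome maps the half-plane onto the punctured unit disc.\<close>

lemma q_eval_inj: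
  assumes "disc_fps f" "disc_fps g" "\<And>z. z \<in> upper_half_plane \<Longrightarrow> q_eval f z = q_eval g z"
  shows "f = g"
proof (rule disc_fps_eqI)
  fix q :: complex assume "norm q < 1" "q \<noteq> 0"
  then obtain z where "z \<in> upper_half_plane" "nome z = q" by (rule nome_surj)
  thus "eval_fps f q = eval_fps g q" using assms(3)[of z] by (simp add: q_eval_def)
qed fact+

lemma q_eval_has_field_derivative:
  assumes f: "disc_fps f" and z: "z \<in> upper_half_plane"
  shows "(q_eval f has_field_derivative 2 * of_real pi * \<i> * q_eval (theta f) z) (at z)"
proof -
  have "(q_eval f has_field_derivative
          eval_fps (fps_deriv f) (nome z) * (2 * of_real pi * \<i> * of_real 1 * nome z)) (at z)"
    unfolding q_eval_def [abs_def]
    by (rule DERIV_chain2[OF has_field_derivative_eval_fps qpow_has_field_derivative])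
       (rule disc_fps_norm_less[OF f norm_nome_less_1[OF z]])
  moreover have "q_eval (theta f) z = nome z * eval_fps (fps_deriv f) (nome z)"
    unfolding q_eval_def theta_def using disc_fps_norm_less[OF f norm_nome_less_1[OF z]]
    by (subst eval_fps_mult) (auto intro: less_le_trans[OF _ fps_conv_radius_deriv])
  ultimately show ?thesis by (simp add: mult_ac)
qed

lemma q_eval_holomorphic: "disc_fps f \<Longrightarrow> q_eval f holomorphic_on upper_half_plane"
  by (subst holomorphic_on_open) (auto intro: q_eval_has_field_derivative)

lemma q_eval_tendsto:
  assumes f: "disc_fps f" and e: "e > 0"
  shows "\<exists>Y>0. \<forall>z. Im z > Y \<longrightarrow> norm (q_eval f z - fps_nth f 0) < e"
proof -
  have "isCont (eval_fps f) 0"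
    using f by (intro continuous_eval_fps) (auto simp: disc_fps_def zero_ereal_def intro: less_le_trans[rotated])
  then obtain d where d: "d > 0" "\<And>q. norm q < d \<Longrightarrow> norm (eval_fps f q - fps_nth f 0) < e"
    using e unfolding continuous_at_eps_delta by (auto simp: dist_norm eval_fps_at_0)
  \<comment> \<open>\<open>- ln d / (2 * pi)\<close> is the height at which the nome has modulus
    \<open>d\<close>; the maximum with 1 only ensures positivity.\<close>
  define Y where "Y = max 1 (- ln d / (2 * pi))"
  have "norm (nome z) < d" if "Im z > Y" for z
  proof -
    have "- ln d / (2 * pi) < Im z" using that by (simp add: Y_def)
    hence "- 2 * pi * Im z < ln d" by (simp add: field_simps)
    hence "exp (- 2 * pi * Im z) < exp (ln d)" by (subst exp_less_cancel_iff)
    thus ?thesis using d(1) by (simp add: norm_nome)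
  qed
  thus ?thesis using d(2) by (intro exI[of _ Y]) (auto simp: q_eval_def Y_def)
qed

text \<open>Holomorphic functions on a connected open set have no zero divisors: \<open>f\<close>
  vanishes on the nonempty open set where \<open>g\<close> does not, hence everywhere. This serves
  to cancel factors that may have zeros.\<close>

lemma holomorphic_mult_eq_0:
  assumes f: "f holomorphic_on S" and g: "g holomorphic_on S" and S: "open S" "connected S"
    and fg: "\<And>z. z \<in> S \<Longrightarrow> f z * g z = 0" and w: "w \<in> S" "g w \<noteq> 0" and z: "z \<in> S"
  shows "f z = 0"
proof -
  define U where "U = {z \<in> S. g z \<noteq> 0}"
  have "U = S \<inter> g -` (- {0})" by (auto simp: U_def)
  hence "open U"
    using continuous_open_preimage[OF holomorphic_on_imp_continuous_on[OF g] S(1)] by auto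
  show ?thesis
  proof (rule analytic_continuation_open[OF \<open>open U\<close> S(1) _ S(2), where f = f and g = "\<lambda>_. 0"])
    show "U \<noteq> {}" "U \<subseteq> S" using w by (auto simp: U_def)
    show "f u = 0" if "u \<in> U" for u using fg[of u] that by (auto simp: U_def)
  qed (use f z in auto)
qed

text \<open>Translations and \<open>z \<mapsto> -1/z\<close>, which at least doubles the imaginary part when
  \<open>\<bar>Re z\<bar> \<le> 1/2\<close> and \<open>Im z < 1/2\<close>, move every point into a half-strip.\<close>

lemma invariant_half_strip:
  fixes f :: "complex \<Rightarrow> 'a"
  assumes T: "\<And>z. z \<in> upper_half_plane \<Longrightarrow> f (z + 1) = f z"
    and S: "\<And>z. z \<in> upper_half_plane \<Longrightarrow> f (- 1 / z) = f z"
    and z: "z \<in> upper_half_plane"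
  shows "\<exists>w. \<bar>Re w\<bar> \<le> 1 / 2 \<and> Im w \<ge> 1 / 2 \<and> f w = f z"
proof -
  have Tn: "f (w + of_nat n) = f w" if "w \<in> upper_half_plane" for w n
  proof (induction n)
    case (Suc n)
    have "w + of_nat n \<in> upper_half_plane" using that by (simp add: upper_half_plane_def)
    from T[OF this] Suc show ?case by (simp add: add_ac)
  qed simp
  have Ti: "f (w - of_int k) = f w" if "w \<in> upper_half_plane" for w k
  proof (cases "k \<ge> 0")
    case True
    have "w - of_int k \<in> upper_half_plane" using that by (simp add: upper_half_plane_def)
    from Tn[OF this, of "nat k"] True show ?thesis by simp
  next
    case False
    with Tn[OF that, of "nat (- k)"] show ?thesis by simp
  qed
  \<comment> \<open>Induction on a number \<open>k\<close> of doublings that suffices to lift the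
    imaginary part to 1/2.\<close>
  have main: "\<exists>w. \<bar>Re w\<bar> \<le> 1 / 2 \<and> Im w \<ge> 1 / 2 \<and> f w = f z"
    if "z \<in> upper_half_plane" "Im z * 2 ^ k \<ge> 1 / 2" for z k
    using that
  proof (induction k arbitrary: z)
    case (0 z)
    have "\<bar>Re (z - of_int (round (Re z)))\<bar> \<le> 1 / 2"
      using of_int_round_abs_le[of "Re z"] by (simp add: abs_minus_commute)
    thus ?case using 0 Ti[of z] by (intro exI[of _ "z - of_int (round (Re z))"]) auto
  next
    case (Suc k z)
    define w where "w = z - of_int (round (Re z))"
    have w: "\<bar>Re w\<bar> \<le> 1 / 2" "f w = f z" "Im w = Im z" "w \<in> upper_half_plane"
      using of_int_round_abs_le[of "Re z"] Ti[of z] Suc.prems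
      by (auto simp: w_def abs_minus_commute upper_half_plane_def)
    show ?case
    proof (cases "Im w \<ge> 1 / 2")
      case False
      have "(Re w)\<^sup>2 \<le> (1 / 2)\<^sup>2" "(Im w)\<^sup>2 \<le> (1 / 2)\<^sup>2"
        using w False by (auto simp: upper_half_plane_def abs_le_square_iff [symmetric])
      hence le: "(Re w)\<^sup>2 + (Im w)\<^sup>2 \<le> 1 / 2" by (simp add: power2_eq_square)
      have pos: "(Re w)\<^sup>2 + (Im w)\<^sup>2 > 0" "Im w > 0"
        using w by (auto simp: upper_half_plane_def intro!: add_nonneg_pos)
      have "Im (- 1 / w) = Im w / ((Re w)\<^sup>2 + (Im w)\<^sup>2)" by (simp add: Im_divide)
      also have "\<dots> \<ge> Im w / (1 / 2)"
        using le pos by (intro divide_left_mono) auto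
      finally have "Im (- 1 / w) * 2 ^ k \<ge> (2 * Im w) * 2 ^ k"
        by (intro mult_right_mono) auto
      hence "Im (- 1 / w) * 2 ^ k \<ge> 1 / 2" using Suc.prems w by simp
      from Suc.IH[OF minus_inverse_in_upper_half_plane[OF w(4)] this]
      show ?thesis using S[OF w(4)] w(2) by simp
    qed (use w in blast)
  qed
  have pos: "Im z > 0" using z by (simp add: upper_half_plane_def)
  obtain k where "1 / (2 * Im z) < 2 ^ k" using real_arch_pow[of 2] by auto
  hence "Im z * 2 ^ k \<ge> 1 / 2" using pos by (simp add: field_simps)
  from main[OF z this] show ?thesis .
qed

text \<open>Decay at the cusp and reduction to the half-strip make the modulus attain its maximum at
  an interior point. By the maximum modulus principle \<open>f\<close> is constant, and the constant
  is the limit 0.\<close>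

lemma invariant_holomorphic_eq_0:
  assumes holo: "f holomorphic_on upper_half_plane"
    and T: "\<And>z. z \<in> upper_half_plane \<Longrightarrow> f (z + 1) = f z"
    and S: "\<And>z. z \<in> upper_half_plane \<Longrightarrow> f (- 1 / z) = f z"
    and lim: "\<And>e. e > 0 \<Longrightarrow> \<exists>Y>0. \<forall>z. Im z > Y \<longrightarrow> norm (f z) < e"
    and z: "z \<in> upper_half_plane"
  shows "f z = 0"
proof (rule ccontr)
  assume "f z \<noteq> 0"
  then obtain Y where Y: "Y > 0" "\<And>w. Im w > Y \<Longrightarrow> norm (f w) < norm (f z)"
    using lim[of "norm (f z)"] by auto
  \<comment> \<open>Above height \<open>Y\<close> the modulus stays below \<open>norm (f z)\<close>,
    so larger values can only occur in this compact part of the half-strip.\<close>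
  define K where "K = cbox (Complex (- 1 / 2) (1 / 2)) (Complex (1 / 2) Y)"
  have K: "w \<in> K \<longleftrightarrow> \<bar>Re w\<bar> \<le> 1 / 2 \<and> Im w \<ge> 1 / 2 \<and> Im w \<le> Y" for w
    by (auto simp: K_def in_cbox_complex_iff)
  have reduce: "\<exists>w\<in>K. f w = f v" if "v \<in> upper_half_plane" "norm (f v) \<ge> norm (f z)" for v
  proof -
    obtain w where "\<bar>Re w\<bar> \<le> 1 / 2" "Im w \<ge> 1 / 2" "f w = f v"
      using invariant_half_strip[of f, OF T S \<open>v \<in> upper_half_plane\<close>] by auto
    moreover from this Y(2)[of w] that(2) have "Im w \<le> Y" by force
    ultimately show ?thesis using K by blast
  qed
  have "K \<subseteq> upper_half_plane" by (auto simp: K upper_half_plane_def)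
  hence "continuous_on K (\<lambda>w. norm (f w))"
    by (intro continuous_intros holomorphic_on_imp_continuous_on holomorphic_on_subset[OF holo])
  moreover have "compact K" "K \<noteq> {}" using reduce[OF z] by (auto simp: K_def)
  ultimately obtain x where x: "x \<in> K" "\<And>w. w \<in> K \<Longrightarrow> norm (f w) \<le> norm (f x)"
    using continuous_attains_sup[of K "\<lambda>w. norm (f w)"] by blast
  have le_z: "norm (f z) \<le> norm (f x)" using reduce[OF z] x(2) by fastforce
  have "norm (f w) \<le> norm (f x)" if "w \<in> upper_half_plane" for w
    using reduce[OF that] x(2) le_z by (cases "norm (f w) \<ge> norm (f z)") fastforce+
  hence "f constant_on upper_half_plane"
    using x(1) \<open>K \<subseteq> upper_half_plane\<close>
    by (intro maximum_modulus_principle[OF holo _ connected_upper_half_plane, of upper_half_plane x]) auto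
  then obtain c where c: "\<And>w. w \<in> upper_half_plane \<Longrightarrow> f w = c" by (auto simp: constant_on_def)
  have "Complex 0 (Y + 1) \<in> upper_half_plane" using Y(1) by (simp add: upper_half_plane_def)
  with c[OF this] c[OF z] Y(2)[of "Complex 0 (Y + 1)"] show False by simp
qed

text \<open>Differentiates a transformation law under \<open>z \<mapsto> - 1 / z\<close>, a map with
  derivative \<open>1 / z ^ 2\<close>.\<close>

lemma deriv_at_minus_inverse:
  assumes holo: "f holomorphic_on upper_half_plane" and z: "z \<in> upper_half_plane"
    and eq: "\<And>w. w \<in> upper_half_plane \<Longrightarrow> f (- 1 / w) = g w"
    and g: "(g has_field_derivative g') (at z)"
  shows "deriv f (- 1 / z) = z ^ 2 * g'"
proof -
  note nz = upper_half_plane_nonzero[OF z]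
  have "(f has_field_derivative deriv f (- 1 / z)) (at (- 1 / z))"
    using holo minus_inverse_in_upper_half_plane[OF z] by (intro holomorphic_derivI) auto
  moreover have "((\<lambda>w. - 1 / w) has_field_derivative 1 / z ^ 2) (at z)"
    using nz by (auto intro!: derivative_eq_intros simp: power2_eq_square)
  ultimately have "((\<lambda>w. f (- 1 / w)) has_field_derivative deriv f (- 1 / z) * (1 / z ^ 2)) (at z)"
    by (rule DERIV_chain2)
  moreover have "((\<lambda>w. f (- 1 / w)) has_field_derivative g') (at z)"
  proof (rule DERIV_cong_ev [THEN iffD1, OF refl _ refl g])
    show "eventually (\<lambda>w. g w = f (- 1 / w)) (nhds z)"
      using eventually_nhds_in_open[OF open_upper_half_plane z] by eventually_elim (rule eq [symmetric])
  qed
  ultimately have "deriv f (- 1 / z) * (1 / z ^ 2) = g'" by (rule DERIV_unique)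
  thus ?thesis using nz by (simp add: field_simps)
qed

section \<open>Transformation laws\<close>

lemma Eisenstein4_eq: "z \<in> upper_half_plane \<Longrightarrow> Eisenstein4 z = q_eval e4 z"
  and Eisenstein6_eq: "z \<in> upper_half_plane \<Longrightarrow> Eisenstein6 z = q_eval e6 z"
  unfolding Eisenstein4_def Eisenstein6_def e4_def e6_def
  by (simp_all only: lambert_sigma norm_nome_less_1 q_eval_simps q_eval_basic disc_fps_intros disc_fps_basic)
     (simp_all add: q_eval_def)

lemma modular_discriminant_eq:
  "z \<in> upper_half_plane \<Longrightarrow> modular_discriminant z = q_eval delta z"
  unfolding modular_discriminant_def delta_def
  by (simp add: q_eval_simps Eisenstein4_eq Eisenstein6_eq disc_fps_intros)

lemma q_eval_eta_recip:
  "z \<in> upper_half_plane \<Longrightarrow> q_eval eta_recip z = inverse (euler_prod (nome z) ^ 12)"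
  unfolding q_eval_def by (rule eval_eta_recip[OF norm_nome_less_1])

lemma sqrt_discriminant_eq:
  assumes "z \<in> upper_half_plane"
  shows "sqrt_discriminant z = qpow (1 / 2) z / q_eval eta_recip z"
proof -
  have "sqrt_discriminant z = qpow (1 / 24) z ^ 12 * euler_prod (nome z) ^ 12"
    unfolding sqrt_discriminant_def dedekind_eta_def euler_prod_def power_mult_distrib ..
  also have "qpow (1 / 24) z ^ 12 = qpow (1 / 2) z"
    unfolding qpow_power by simp
  finally show ?thesis 
    by (simp only: q_eval_eta_recip[OF assms] divide_inverse [of "qpow _ _"] inverse_inverse_eq)
qed

lemma q_eval_eta_recip_nonzero: "z \<in> upper_half_plane \<Longrightarrow> q_eval eta_recip z \<noteq> 0"
  using euler_prod_nonzero[OF norm_nome_less_1, of z] by (simp add: q_eval_eta_recip)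

lemma sqrt_discriminant_nonzero: "z \<in> upper_half_plane \<Longrightarrow> sqrt_discriminant z \<noteq> 0"
  by (simp add: sqrt_discriminant_eq q_eval_eta_recip_nonzero)

lemma sqrt_discriminant_squared:
  assumes z: "z \<in> upper_half_plane"
  shows "sqrt_discriminant z ^ 2 = modular_discriminant z"
proof -
  have "q_eval delta z * q_eval eta_recip z ^ 2 = q_eval (delta * eta_recip ^ 2) z"
    by (simp add: q_eval_simps z disc_fps_intros)
  also have "\<dots> = qpow (1 / 2) z ^ 2"
    unfolding delta_eta_recip qpow_power by simp
  finally have "qpow (1 / 2) z ^ 2 = q_eval delta z * q_eval eta_recip z ^ 2" ..
  thus ?thesis using q_eval_eta_recip_nonzero[OF z]
    unfolding sqrt_discriminant_eq[OF z] modular_discriminant_eq[OF z] power_divide by simp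
qed

lemma sqrt_discriminant_holomorphic: "sqrt_discriminant holomorphic_on upper_half_plane"
proof -
  have "qpow (1 / 2) holomorphic_on upper_half_plane"
    unfolding qpow_def [abs_def] by (intro holomorphic_intros)
  hence "(\<lambda>z. qpow (1 / 2) z / q_eval eta_recip z) holomorphic_on upper_half_plane"
    by (intro holomorphic_intros q_eval_holomorphic disc_fps_intros q_eval_eta_recip_nonzero)
  thus ?thesis by (rule holomorphic_transform) (simp add: sqrt_discriminant_eq)
qed

lemma solves_ode2D:
  assumes "solves_ode2 Q y" "z \<in> upper_half_plane"
  shows "(y has_field_derivative deriv y z) (at z)"
    and "(deriv y has_field_derivative Q z * y z) (at z)"
proof -
  have y: "y holomorphic_on upper_half_plane" using assms by (simp add: solves_ode2_def)
  show "(y has_field_derivative deriv y z) (at z)"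
    using y assms(2) by (intro holomorphic_derivI) auto
  have "(deriv y has_field_derivative deriv (deriv y) z) (at z)"
    using holomorphic_deriv[OF y] assms(2) by (intro holomorphic_derivI) auto
  moreover have "deriv (deriv y) z = Q z * y z"
    using assms by (simp add: solves_ode2_def numeral_2_eq_2)
  ultimately show "(deriv y has_field_derivative Q z * y z) (at z)" by simp
qed

text \<open>The bracket \<open>2 F F'' - F'\<^sup>2\<close> of a form of weight \<open>-2\<close> is a form of weight \<open>0\<close>, whereas for a
  quadratic form \<open>F\<close> in the solutions it differs from \<open>4 Q F\<^sup>2\<close> by a constant multiple of the
  squared Wronskian. So \<open>Q\<close> inherits weight \<open>4\<close> from \<open>F\<close>.\<close>

lemma potential_weight_4:
  fixes c :: complex
  assumes y1: "solves_ode2 Q y1" and y2: "solves_ode2 Q y2"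
  defines "F \<equiv> \<lambda>z. y1 z ^ 2 + c * y2 z ^ 2"
  assumes S: "\<And>z. z \<in> upper_half_plane \<Longrightarrow> F (- 1 / z) = - F z / z ^ 2"
  assumes z: "z \<in> upper_half_plane"
  shows "(Q (- 1 / z) - z ^ 4 * Q z) * F z ^ 2 = 0"
proof -
  \<comment> \<open>\<open>F1\<close> and \<open>F2\<close> are the first two derivatives of
    \<open>F\<close>, with second derivatives of the solutions eliminated by the differential
    equation.\<close>
  define F1 where "F1 = (\<lambda>z. 2 * (y1 z * deriv y1 z) + 2 * c * (y2 z * deriv y2 z))"
  define F2 where "F2 = (\<lambda>z. 2 * Q z * F z + 2 * (deriv y1 z ^ 2 + c * deriv y2 z ^ 2))"
  define W where "W = (\<lambda>z. y1 z * deriv y2 z - y2 z * deriv y1 z)"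
  note [derivative_intros] = solves_ode2D[OF y1] solves_ode2D[OF y2]
  have dF: "(F has_field_derivative F1 w) (at w)" if "w \<in> upper_half_plane" for w
    unfolding F_def F1_def using that by (auto intro!: derivative_eq_intros simp: algebra_simps)
  have dF1: "(F1 has_field_derivative F2 w) (at w)" if "w \<in> upper_half_plane" for w
    unfolding F1_def F2_def F_def using that
    by (auto intro!: derivative_eq_intros simp: algebra_simps power2_eq_square)
  have "\<exists>C. \<forall>w\<in>upper_half_plane. W w = C"
  proof (rule has_field_derivative_zero_constant[OF convex_upper_half_plane])
    fix w assume w: "w \<in> upper_half_plane"
    have "(W has_field_derivative 0) (at w)"
      unfolding W_def using w by (auto intro!: derivative_eq_intros simp: algebra_simps)
    thus "(W has_field_derivative 0) (at w within upper_half_plane)"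
      by (rule has_field_derivative_at_within)
  qed
  then obtain C where C: "\<And>w. w \<in> upper_half_plane \<Longrightarrow> W w = C" by blast
  \<comment> \<open>The constant is \<open>4 * c\<close> times the squared Wronskian. It is the same
    at \<open>z\<close> and at \<open>- 1 / z\<close>, so it drops out of the comparison.\<close>
  have bracket: "2 * F w * F2 w - F1 w ^ 2 = 4 * Q w * F w ^ 2 + 4 * c * C ^ 2"
    if "w \<in> upper_half_plane" for w
    unfolding C[OF that, symmetric] F_def F1_def F2_def W_def by algebra
  have F_holo: "F holomorphic_on upper_half_plane" and F1_holo: "F1 holomorphic_on upper_half_plane"
    using dF dF1 by (auto simp: holomorphic_on_open)
  have derivs: "deriv F w = F1 w" "deriv F1 w = F2 w" if "w \<in> upper_half_plane" for w
    using dF dF1 that by (auto intro: DERIV_imp_deriv)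
  have F1_S: "F1 (- 1 / w) = 2 * F w / w - F1 w" if w: "w \<in> upper_half_plane" for w
  proof -
    have "((\<lambda>w. - F w / w ^ 2) has_field_derivative (2 * F w / w - F1 w) / w ^ 2) (at w)"
      using dF[OF w] upper_half_plane_nonzero[OF w]
      by (auto intro!: derivative_eq_intros simp: field_simps power_numeral_reduce)
    from deriv_at_minus_inverse[OF F_holo w S this] show ?thesis
      using upper_half_plane_nonzero[OF w] derivs minus_inverse_in_upper_half_plane[OF w] by simp
  qed
  have nz: "z \<noteq> 0" by (rule upper_half_plane_nonzero[OF z])
  have "((\<lambda>w. 2 * F w / w - F1 w) has_field_derivative (2 * F1 z / z - 2 * F z / z ^ 2 - F2 z)) (at z)"
    using dF[OF z] dF1[OF z] nz
    by (auto intro!: derivative_eq_intros simp: field_simps power_numeral_reduce)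
  from deriv_at_minus_inverse[OF F1_holo z F1_S this]
  have "F2 (- 1 / z) = z ^ 2 * (2 * F1 z / z - 2 * F z / z ^ 2 - F2 z)"
    using derivs minus_inverse_in_upper_half_plane[OF z] by simp
  also have "\<dots> = 2 * z * F1 z - 2 * F z - z ^ 2 * F2 z"
    using nz by (simp add: field_simps power2_eq_square)
  finally have F2_S: "F2 (- 1 / z) = 2 * z * F1 z - 2 * F z - z ^ 2 * F2 z" .
  have "2 * F (- 1 / z) * F2 (- 1 / z) - F1 (- 1 / z) ^ 2 = 2 * F z * F2 z - F1 z ^ 2"
    unfolding S[OF z] F1_S[OF z] F2_S using nz by (simp add: field_simps power_numeral_reduce)
  hence "4 * Q (- 1 / z) * F (- 1 / z) ^ 2 = 4 * Q z * F z ^ 2"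
    unfolding bracket[OF z] bracket[OF minus_inverse_in_upper_half_plane[OF z]] by simp
  hence "Q (- 1 / z) * F z ^ 2 = z ^ 4 * Q z * F z ^ 2"
    unfolding S[OF z] using nz by (simp add: field_simps)
  thus ?thesis by (simp add: algebra_simps)
qed

text \<open>Differentiating the law of \<open>e4\<close> twice produces lower-order terms, and these
  cancel in the combination of \<open>delta_bracket\<close>.\<close>

lemma delta_weight_12:
  assumes E4: "\<And>z. z \<in> upper_half_plane \<Longrightarrow> q_eval e4 (- 1 / z) = z ^ 4 * q_eval e4 z"
    and z: "z \<in> upper_half_plane"
  shows "q_eval delta (- 1 / z) = z ^ 12 * q_eval delta z"
proof -
  define k where "k = 2 * of_real pi * \<i>"
  have k: "k \<noteq> 0" by (simp add: k_def)
  define D1 where "D1 = (\<lambda>z. k * q_eval (theta e4) z)"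
  define D2 where "D2 = (\<lambda>z. k ^ 2 * q_eval (theta (theta e4)) z)"
  have d: "(q_eval e4 has_field_derivative D1 w) (at w)"
          "(D1 has_field_derivative D2 w) (at w)" if "w \<in> upper_half_plane" for w
  proof -
    show "(q_eval e4 has_field_derivative D1 w) (at w)"
      unfolding D1_def k_def by (rule q_eval_has_field_derivative) (intro disc_fps_intros that)+
    have "((\<lambda>z. k * q_eval (theta e4) z) has_field_derivative k * (k * q_eval (theta (theta e4)) w)) (at w)"
      unfolding k_def by (intro DERIV_cmult q_eval_has_field_derivative disc_fps_intros that)
    thus "(D1 has_field_derivative D2 w) (at w)" by (simp add: D1_def D2_def power2_eq_square mult_ac)
  qed
  have holo: "q_eval e4 holomorphic_on upper_half_plane" "D1 holomorphic_on upper_half_plane"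
    using d by (auto simp: holomorphic_on_open)
  have derivs: "deriv (q_eval e4) w = D1 w" "deriv D1 w = D2 w" if "w \<in> upper_half_plane" for w
    using d that by (auto intro: DERIV_imp_deriv)
  have delta: "960 * k ^ 2 * q_eval delta w = 4 * q_eval e4 w * D2 w - 5 * D1 w ^ 2"
    if w: "w \<in> upper_half_plane" for w
  proof -
    have "960 * k ^ 2 * q_eval delta w = k ^ 2 * q_eval (960 * delta) w"
      by (simp add: q_eval_simps w disc_fps_intros)
    also have "\<dots> = k ^ 2 * (4 * q_eval e4 w * q_eval (theta (theta e4)) w - 5 * q_eval (theta e4) w ^ 2)"
      unfolding delta_bracket by (simp add: q_eval_simps w disc_fps_intros)
    also have "\<dots> = 4 * q_eval e4 w * D2 w - 5 * D1 w ^ 2"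
      by (simp add: D1_def D2_def algebra_simps power2_eq_square)
    finally show ?thesis .
  qed
  have D1_S: "D1 (- 1 / w) = 4 * w ^ 5 * q_eval e4 w + w ^ 6 * D1 w" if w: "w \<in> upper_half_plane" for w
  proof -
    have "((\<lambda>w. w ^ 4 * q_eval e4 w) has_field_derivative 4 * w ^ 3 * q_eval e4 w + w ^ 4 * D1 w) (at w)"
      using d[OF w] by (auto intro!: derivative_eq_intros simp: algebra_simps)
    from deriv_at_minus_inverse[OF holo(1) w E4 this] show ?thesis
      using derivs minus_inverse_in_upper_half_plane[OF w]
      by (simp add: algebra_simps power_numeral_reduce)
  qed
  have "((\<lambda>w. 4 * w ^ 5 * q_eval e4 w + w ^ 6 * D1 w) has_field_derivative
          20 * z ^ 4 * q_eval e4 z + 10 * z ^ 5 * D1 z + z ^ 6 * D2 z) (at z)"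
    using d[OF z] by (auto intro!: derivative_eq_intros simp: algebra_simps power_numeral_reduce)
  from deriv_at_minus_inverse[OF holo(2) z D1_S this]
  have D2_S: "D2 (- 1 / z) = z ^ 2 * (20 * z ^ 4 * q_eval e4 z + 10 * z ^ 5 * D1 z + z ^ 6 * D2 z)"
    using derivs minus_inverse_in_upper_half_plane[OF z] by simp
  have "960 * k ^ 2 * q_eval delta (- 1 / z) = z ^ 12 * (4 * q_eval e4 z * D2 z - 5 * D1 z ^ 2)"
    unfolding delta[OF minus_inverse_in_upper_half_plane[OF z]] E4[OF z] D1_S[OF z] D2_S by algebra
  also have "\<dots> = 960 * k ^ 2 * (z ^ 12 * q_eval delta z)"
    unfolding delta[OF z, symmetric] by (simp add: mult_ac)
  finally show ?thesis using k by simp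
qed

lemma i_in_upper_half_plane: "\<i> \<in> upper_half_plane"
  by (simp add: upper_half_plane_def)

text \<open>The sign in the transformation law of the square root is read off at the fixed point \<open>\<i>\<close>.\<close>

lemma sqrt_discriminant_weight_6:
  assumes delta: "\<And>z. z \<in> upper_half_plane \<Longrightarrow> q_eval delta (- 1 / z) = z ^ 12 * q_eval delta z"
    and z: "z \<in> upper_half_plane"
  shows "sqrt_discriminant (- 1 / z) = - (z ^ 6 * sqrt_discriminant z)"
proof -
  let ?h = sqrt_discriminant
  have comp: "(\<lambda>z. ?h (- 1 / z)) holomorphic_on upper_half_plane"
  proof -
    have "(\<lambda>z. - 1 / z) ` upper_half_plane \<subseteq> upper_half_plane"
      using minus_inverse_in_upper_half_plane by blast
    hence "(?h \<circ> (\<lambda>z. - 1 / z)) holomorphic_on upper_half_plane"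
      by (intro holomorphic_on_compose_gen[OF _ sqrt_discriminant_holomorphic] holomorphic_intros)
         (auto dest: upper_half_plane_nonzero)
    thus ?thesis by (simp add: o_def)
  qed
  have "?h (- 1 / z) + z ^ 6 * ?h z = 0"
  proof (rule holomorphic_mult_eq_0[where f = "\<lambda>z. ?h (- 1 / z) + z ^ 6 * ?h z"
        and g = "\<lambda>z. ?h (- 1 / z) - z ^ 6 * ?h z"])
    show "(\<lambda>z. ?h (- 1 / z) + z ^ 6 * ?h z) holomorphic_on upper_half_plane"
      "(\<lambda>z. ?h (- 1 / z) - z ^ 6 * ?h z) holomorphic_on upper_half_plane"
      by (intro holomorphic_intros comp sqrt_discriminant_holomorphic)+
    fix w assume w: "w \<in> upper_half_plane"
    have "?h (- 1 / w) ^ 2 = w ^ 12 * ?h w ^ 2"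
      by (simp only: sqrt_discriminant_squared modular_discriminant_eq delta w
            minus_inverse_in_upper_half_plane)
    thus "(?h (- 1 / w) + w ^ 6 * ?h w) * (?h (- 1 / w) - w ^ 6 * ?h w) = 0" by algebra
  next
    \<comment> \<open>At the fixed point the difference equals twice the nonzero value
      \<open>?h \<i>\<close>, because \<open>\<i> ^ 6 = - 1\<close>. So it is the factor with the
      plus sign that vanishes identically.\<close>
    have "- 1 / \<i> = \<i>" by (simp add: divide_i)
    thus "?h (- 1 / \<i>) - \<i> ^ 6 * ?h \<i> \<noteq> 0"
      using sqrt_discriminant_nonzero[OF i_in_upper_half_plane] by (simp add: power_numeral_reduce)
  qed (use z connected_upper_half_plane i_in_upper_half_plane in auto)
  thus ?thesis by (simp add: add_eq_0_iff)
qed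

section \<open>Rationality of the coefficients\<close>

definition rat_fps :: "complex fps \<Rightarrow> bool" where
  "rat_fps f \<longleftrightarrow> (\<forall>n. fps_nth f n \<in> \<rat>)"

lemma rat_fps_mult: "rat_fps f \<Longrightarrow> rat_fps g \<Longrightarrow> rat_fps (f * g)"
  by (auto simp: rat_fps_def fps_mult_nth intro!: Rats_sum Rats_mult)

lemma rat_fps_power: "rat_fps f \<Longrightarrow> rat_fps (f ^ m)"
proof (induction m)
  case 0
  show ?case by (simp add: rat_fps_def)
qed (simp add: rat_fps_mult)

lemma sigma_rat: "divisor_sum k n \<in> \<rat>"
  unfolding divisor_sum_def by (intro Rats_sum Rats_power Rats_of_nat)

lemma rat_fps_e4: "rat_fps e4"
  by (auto simp: rat_fps_def e4_def sigma_rat)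

text \<open>As \<open>r\<close> has no constant term, the right-hand side at \<open>j\<close>
  involves only earlier coefficients of \<open>a\<close>, and \<open>w j\<close> can be divided
  out.\<close>

lemma rat_fps_recurrence:
  assumes "rat_fps r" "fps_nth r 0 = 0" "fps_nth a 0 \<in> \<rat>"
    and w: "\<And>j. j > 0 \<Longrightarrow> w j \<noteq> 0 \<and> w j \<in> \<rat>"
    and rec: "\<And>j. j > 0 \<Longrightarrow> w j * fps_nth a j = fps_nth (r * a) j"
  shows "rat_fps a"
  unfolding rat_fps_def
proof
  fix j show "fps_nth a j \<in> \<rat>"
  proof (induction j rule: less_induct)
    case (less j)
    show ?case
    proof (cases "j = 0")
      case False
      have "w j * fps_nth a j = (\<Sum>i = 0..j. fps_nth r i * fps_nth a (j - i))"
        using rec[of j] False by (simp add: fps_mult_nth)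
      also have "\<dots> \<in> \<rat>"
      proof (intro Rats_sum)
        fix i assume "i \<in> {0..j}"
        thus "fps_nth r i * fps_nth a (j - i) \<in> \<rat>"
          using less.IH[of "j - i"] assms(1,2) False by (cases "i = 0") (auto simp: rat_fps_def intro: Rats_mult)
      qed
      finally have "w j * fps_nth a j / w j \<in> \<rat>" using w[of j] False by (intro Rats_divide) auto
      thus ?thesis using w[of j] False by simp
    qed (use assms in simp)
  qed
qed

lemma rat_fps_eta_recip: "rat_fps eta_recip"
proof (rule rat_fps_recurrence)
  show "rat_fps (12 * sigma_fps 1)" by (simp add: rat_fps_def sigma_rat)
  show "of_nat j * fps_nth eta_recip j = fps_nth (12 * sigma_fps 1 * eta_recip) j" for j
    unfolding theta_eta_recip [symmetric] by simp
qed (auto simp: eta_recip_0)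

text \<open>Every real number strictly between 0 and 1 is a value of the nome, so summability on the
  half-plane forces radius of convergence at least 1.\<close>

lemma normalized_q_expansion:
  assumes "has_normalized_q_expansion y s"
  shows "\<exists>a. disc_fps a \<and> fps_nth a 0 = 1 \<and> (\<forall>z\<in>upper_half_plane. y z = qpow s z * q_eval a z)"
proof -
  obtain b where *: "\<forall>z\<in>upper_half_plane. summable (\<lambda>j. b (Suc j) * nome z ^ Suc j) \<and>
      y z = qpow s z * (1 + (\<Sum>j. b (Suc j) * nome z ^ Suc j))"
    using assms unfolding has_normalized_q_expansion_def by (rule exE)
  note b = *[rule_format, THEN conjunct1] *[rule_format, THEN conjunct2]
  define a where "a = Abs_fps (\<lambda>j. if j = 0 then 1 else b j)"
  have summable: "summable (\<lambda>j. fps_nth a j * nome z ^ j)" if "z \<in> upper_half_plane" for z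
    using b(1)[OF that] by (subst summable_Suc_iff [symmetric]) (simp add: a_def)
  have "1 \<le> fps_conv_radius a"
    unfolding fps_conv_radius_def
  proof (rule conv_radius_geI_ex')
    fix r :: real assume "0 < r" "ereal r < 1"
    hence "norm (of_real r :: complex) < 1" "of_real r \<noteq> (0 :: complex)" by auto
    then obtain z where "z \<in> upper_half_plane" "nome z = of_real r" by (rule nome_surj)
    with summable[of z] show "summable (\<lambda>n. fps_nth a n * of_real r ^ n)" by simp
  qed
  moreover have "y z = qpow s z * q_eval a z" if "z \<in> upper_half_plane" for z
  proof -
    have "(\<Sum>j. b (Suc j) * nome z ^ Suc j) = (\<Sum>j. fps_nth a (Suc j) * nome z ^ Suc j)"
      by (simp only: a_def fps_nth_Abs_fps nat.distinct if_False)
    also have "\<dots> = q_eval a z - 1"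
      unfolding suminf_split_head[OF summable[OF that]] q_eval_def eval_fps_def by (simp add: a_def)
    finally show ?thesis using b(2)[OF that] by simp
  qed
  ultimately show ?thesis by (intro exI[of _ a]) (simp add: disc_fps_def, simp add: a_def)
qed

lemma qpow_q_eval_has_field_derivative:
  assumes a: "disc_fps a" and z: "z \<in> upper_half_plane"
  shows "((\<lambda>z. qpow s z * q_eval a z) has_field_derivative
           2 * of_real pi * \<i> * (qpow s z * q_eval (fps_const (of_real s) * a + theta a) z)) (at z)"
  by (rule derivative_eq_intros q_eval_has_field_derivative qpow_has_field_derivative a z)+
     (simp add: q_eval_simps a z disc_fps_intros algebra_simps)

text \<open>On \<open>qpow s\<close> times a series in \<open>q\<close>, the operator
  \<open>D\<close> acts on the series as \<open>s + theta\<close>. Since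
  \<open>(2 pi i)^2 s^2 = - pi^2 (n/2)^2\<close>, the equation becomes
  \<open>(s + theta)^2 a = s^2 e4 a\<close>; the constant term of \<open>e4\<close> is then moved to
  the left.\<close>

lemma ode_recurrence:
  assumes y: "solves_ode2 (potential n) y"
    and a: "disc_fps a" and eq: "\<And>z. z \<in> upper_half_plane \<Longrightarrow> y z = qpow s z * q_eval a z"
    and s: "s ^ 2 = (real n / 4) ^ 2"
  shows "(of_nat j ^ 2 + 2 * of_real s * of_nat j) * fps_nth a j =
         fps_nth (fps_const (of_real (s ^ 2)) * (e4 - 1) * a) j"
proof -
  define b where "b = fps_const (of_real s) * a + theta a"
  define c where "c = fps_const (of_real s) * b + theta b"
  define k where "k = 2 * of_real pi * \<i>"
  have bc: "disc_fps b" "disc_fps c" unfolding b_def c_def by (intro disc_fps_intros a)+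
  have c: "c = fps_const (of_real (s ^ 2)) * e4 * a"
  proof (rule q_eval_inj)
    fix z assume z: "z \<in> upper_half_plane"
    have d1: "deriv y w = k * (qpow s w * q_eval b w)" if w: "w \<in> upper_half_plane" for w
    proof -
      have "eventually (\<lambda>w. y w = qpow s w * q_eval a w) (nhds w)"
        using eventually_nhds_in_open[OF open_upper_half_plane w] by eventually_elim (rule eq)
      hence "deriv y w = deriv (\<lambda>w. qpow s w * q_eval a w) w" by (intro deriv_cong_ev refl)
      also have "\<dots> = k * (qpow s w * q_eval b w)"
        unfolding k_def b_def by (intro DERIV_imp_deriv qpow_q_eval_has_field_derivative a w)
      finally show ?thesis .
    qed
    have "eventually (\<lambda>w. deriv y w = k * (qpow s w * q_eval b w)) (nhds z)"
      using eventually_nhds_in_open[OF open_upper_half_plane z] by eventually_elim (rule d1)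
    hence "deriv (deriv y) z = deriv (\<lambda>w. k * (qpow s w * q_eval b w)) z"
      by (intro deriv_cong_ev refl)
    also have "\<dots> = k * (k * (qpow s z * q_eval c z))"
      unfolding k_def c_def
      by (intro DERIV_imp_deriv DERIV_cmult qpow_q_eval_has_field_derivative bc z)
    also have "deriv (deriv y) z = potential n z * (qpow s z * q_eval a z)"
      using DERIV_imp_deriv[OF solves_ode2D(2)[OF y z]] eq[OF z] by simp
    finally have "k ^ 2 * q_eval c z * qpow s z = potential n z * q_eval a z * qpow s z"
      by (simp add: power2_eq_square mult_ac)
    hence "k ^ 2 * q_eval c z = potential n z * q_eval a z" by simp
    also have "potential n z = k ^ 2 * (of_real (s ^ 2) * q_eval e4 z)"
      unfolding s by (simp add: potential_def k_def Eisenstein4_eq[OF z] power2_eq_square)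
    finally have "q_eval c z = of_real (s ^ 2) * q_eval e4 z * q_eval a z"
      by (simp add: k_def)
    thus "q_eval c z = q_eval (fps_const (of_real (s ^ 2)) * e4 * a) z"
      by (simp add: q_eval_simps z a disc_fps_intros)
  qed (intro disc_fps_intros a bc)+
  have "fps_nth c j = (of_real s + of_nat j) ^ 2 * fps_nth a j"
    by (simp add: c_def b_def algebra_simps power2_eq_square)
  moreover have "fps_const (of_real (s ^ 2)) * (e4 - 1) * a = c - fps_const (of_real (s ^ 2)) * a"
    unfolding c by (simp add: algebra_simps)
  ultimately show ?thesis by (simp add: algebra_simps power2_eq_square)
qed

text \<open>In the application \<open>J\<close> is \<open>q\<close> times the j-function and
  \<open>B\<close> is \<open>q ^ N\<close> times an invariant function, so this is the usual
  stripping of polar terms by powers of j. The constant coefficient of \<open>R\<close> involves the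
  coefficient of \<open>B\<close> at \<open>N\<close>, for which rationality is not assumed; hence
  the range \<open>{1..N}\<close>.\<close>

lemma polar_part_poly:
  assumes J: "rat_fps J" "fps_nth J 0 = 1"
    and B: "\<And>k. k < N \<Longrightarrow> fps_nth B k \<in> \<rat>"
  shows "\<exists>R G. degree R \<le> N \<and> coeff R N = fps_nth B 0 \<and> (\<forall>i\<in>{1..N}. coeff R i \<in> \<rat>) \<and>
           B = (\<Sum>i\<le>N. fps_const (coeff R i) * J ^ i * fps_X ^ (N - i)) + fps_X ^ Suc N * G"
  using B
proof (induction N arbitrary: B)
  case 0
  have "B = fps_const (fps_nth B 0) + fps_X * fps_shift 1 B"
    by (rule fps_ext) simp
  thus ?case by (intro exI[of _ "[:fps_nth B 0:]"] exI[of _ "fps_shift 1 B"]) simp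
next
  case (Suc N)
  define b where "b = fps_nth B 0"
  \<comment> \<open>Subtracting \<open>b * J ^ Suc N\<close> removes the leading polar term; the
    shift divides by \<open>q\<close>.\<close>
  define C where "C = fps_shift 1 (B - fps_const b * J ^ Suc N)"
  have b: "b \<in> \<rat>" using Suc.prems[of 0] by (simp add: b_def)
  have BC: "B = fps_const b * J ^ Suc N + fps_X * C"
    by (rule fps_ext) (simp add: C_def b_def fps_power_zeroth J del: power_Suc)
  have "fps_nth C k \<in> \<rat>" if "k < N" for k
    using Suc.prems[of "Suc k"] that rat_fps_power[OF J(1), of "Suc N"] b
    by (auto simp: C_def rat_fps_def simp del: power_Suc intro!: Rats_diff Rats_mult)
  from Suc.IH[OF this] obtain R G where R: "degree R \<le> N" "\<And>i. i \<in> {1..N} \<Longrightarrow> coeff R i \<in> \<rat>"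
    and C: "C = (\<Sum>i\<le>N. fps_const (coeff R i) * J ^ i * fps_X ^ (N - i)) + fps_X ^ Suc N * G"
    by blast
  define R' where "R' = monom b (Suc N) + R"
  have R': "coeff R' i = (if i = Suc N then b else coeff R i)" for i
    using R(1) by (auto simp: R'_def coeff_eq_0)
  have "(\<Sum>i\<le>Suc N. fps_const (coeff R' i) * J ^ i * fps_X ^ (Suc N - i)) =
        (\<Sum>i\<le>N. fps_const (coeff R' i) * J ^ i * fps_X ^ (Suc N - i)) + fps_const b * J ^ Suc N"
    by (simp add: R' del: power_Suc)
  also have "(\<Sum>i\<le>N. fps_const (coeff R' i) * J ^ i * fps_X ^ (Suc N - i)) =
        fps_X * (\<Sum>i\<le>N. fps_const (coeff R i) * J ^ i * fps_X ^ (N - i))"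
    unfolding sum_distrib_left by (intro sum.cong refl) (simp add: R' Suc_diff_le mult_ac)
  finally have "B = (\<Sum>i\<le>Suc N. fps_const (coeff R' i) * J ^ i * fps_X ^ (Suc N - i)) + fps_X ^ Suc (Suc N) * G"
    unfolding BC C by (simp add: algebra_simps)
  moreover have "degree R' \<le> Suc N" 
    using R(1) by (intro degree_le) (auto simp: R' coeff_eq_0)
  moreover have "\<forall>i\<in>{1..Suc N}. coeff R' i \<in> \<rat>" using R(2) b by (auto simp: R')
  ultimately show ?case by (intro exI[of _ R'] exI[of _ G]) (auto simp: R' b_def)
qed

lemma map_poly_of_rat_exists:
  fixes p :: "'a :: field_char_0 poly"
  assumes "\<And>i. coeff p i \<in> \<rat>"
  obtains P where "map_poly of_rat P = p"
proof -
  define f where "f = (\<lambda>x :: 'a. SOME r. of_rat r = x)"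
  have f: "of_rat (f x) = x" if "x \<in> \<rat>" for x
    unfolding f_def using that by (intro someI_ex[of "\<lambda>r. of_rat r = x"]) (auto elim: Rats_cases)
  have "f 0 = 0" using f[of 0] by simp
  have "map_poly of_rat (map_poly f p) = p"
    by (rule poly_eqI) (simp add: coeff_map_poly \<open>f 0 = 0\<close> f assms)
  thus ?thesis by (rule that)
qed

lemma disc_fps_of_X_power_mult:
  assumes "disc_fps (fps_X ^ m * G)"
  shows "disc_fps G"
proof -
  have "fps_shift m (fps_X ^ m * G) = G" by (rule fps_ext) (simp add: fps_X_power_mult_nth)
  thus ?thesis using assms unfolding disc_fps_def by (metis fps_conv_radius_shift)
qed

lemma q_eval_add_1: "q_eval f (z + 1) = q_eval f z"
  by (simp only: q_eval_def nome_add_1)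

lemma q_eval_delta_eta_recip: 
  assumes "z \<in> upper_half_plane"
  shows "q_eval delta z * q_eval eta_recip z ^ 2 = nome z"
proof -
  have "q_eval delta z * q_eval eta_recip z ^ 2 = q_eval (delta * eta_recip ^ 2) z"
    by (simp add: q_eval_simps assms disc_fps_intros)
  thus ?thesis by (simp add: delta_eta_recip)
qed

lemma klein_j_eq:
  assumes z: "z \<in> upper_half_plane"
  shows "klein_j z = q_eval (e4 ^ 3 * eta_recip ^ 2) z / nome z"
proof -
  have "klein_j z = q_eval e4 z ^ 3 / q_eval delta z"
    by (simp add: klein_j_def Eisenstein4_eq modular_discriminant_eq z)
  also have "\<dots> = q_eval e4 z ^ 3 * q_eval eta_recip z ^ 2 / nome z"
    unfolding q_eval_delta_eta_recip[OF z, symmetric] using q_eval_eta_recip_nonzero[OF z] by simp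
  finally show ?thesis by (simp add: q_eval_simps z disc_fps_intros)
qed

lemma klein_j_sqrt_discriminant:
  "z \<in> upper_half_plane \<Longrightarrow> klein_j z = q_eval e4 z ^ 3 / sqrt_discriminant z ^ 2"
  by (simp add: klein_j_def sqrt_discriminant_squared Eisenstein4_eq)

text \<open>The primitive cube root of unity \<open>r\<close> is fixed by
  \<open>z \<mapsto> - 1 / (z + 1)\<close>, and its automorphy factor
  \<open>(r + 1) ^ 4 = - (r + 1)\<close> differs from 1.\<close>

lemma q_eval_e4_elliptic_zero:
  assumes "\<And>z. z \<in> upper_half_plane \<Longrightarrow> q_eval e4 (- 1 / z) = z ^ 4 * q_eval e4 z"
  obtains r where "r \<in> upper_half_plane" "q_eval e4 r = 0"
proof
  define r where "r = Complex (- 1 / 2) (sqrt 3 / 2)"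
  show r: "r \<in> upper_half_plane" by (simp add: r_def upper_half_plane_def)
  hence r1: "r + 1 \<in> upper_half_plane" by (simp add: upper_half_plane_def)
  have sq: "r ^ 2 + r + 1 = 0"
    by (simp add: r_def complex_eq_iff power2_eq_square)
  hence "r * (r + 1) = - 1" by algebra
  hence "- 1 / (r + 1) = r" using upper_half_plane_nonzero[OF r1] by (simp add: field_simps)
  hence "q_eval e4 r = (r + 1) ^ 4 * q_eval e4 r"
    using assms[OF r1] by (simp only: q_eval_add_1)
  moreover have "(r + 1) ^ 4 = - (r + 1)" using sq by algebra
  ultimately have "(r + 2) * q_eval e4 r = 0" by algebra
  moreover have "r + 2 \<noteq> 0" by (simp add: r_def complex_eq_iff)
  ultimately show "q_eval e4 r = 0" by simp
qed

lemma poly_eq_sum: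
  assumes "degree (p :: 'a :: comm_semiring_1 poly) \<le> N"
  shows "poly p x = (\<Sum>i\<le>N. coeff p i * x ^ i)"
  unfolding poly_altdef using assms
  by (intro sum.mono_neutral_left) (auto simp: coeff_eq_0)

theorem corollary1p5:
  fixes n :: nat and y_plus y_minus F :: "complex \<Rightarrow> complex" and c :: complex
  assumes "n > 0" and "odd n"
    and "solves_ode2 (potential n) y_plus"
    and "has_normalized_q_expansion y_plus (real n / 4)"
    and "solves_ode2 (potential n) y_minus"
    and "has_normalized_q_expansion y_minus (- (real n / 4))"
    and "F = (\<lambda>z. y_minus z ^ 2 + c * y_plus z ^ 2)"
    and "\<And>z. z \<in> upper_half_plane \<Longrightarrow> slash F (- 2) mat_T z = - F z"
    and "\<And>z. z \<in> upper_half_plane \<Longrightarrow> slash F (- 2) mat_S z = - F z"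
  shows "\<exists>P :: rat poly. degree P = (n - 1) div 2 \<and>
           (\<forall>z\<in>upper_half_plane.
              F z = Eisenstein4 z / sqrt_discriminant z * poly (map_poly of_rat P) (klein_j z))"
proof -
  let ?h = sqrt_discriminant
  note H = minus_inverse_in_upper_half_plane

  \<comment> \<open>The expansion of \<open>F\<close> at the cusp\<close>
  obtain m where n: "n = 2 * m + 1" using \<open>odd n\<close> by (elim oddE)
  obtain a where a: "disc_fps a" "fps_nth a 0 = 1"
    "\<And>z. z \<in> upper_half_plane \<Longrightarrow> y_minus z = qpow (- (real n / 4)) z * q_eval a z"
    using normalized_q_expansion[OF assms(6)] by blast
  obtain b where b: "disc_fps b" "fps_nth b 0 = 1"
    "\<And>z. z \<in> upper_half_plane \<Longrightarrow> y_plus z = qpow (real n / 4) z * q_eval b z"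
    using normalized_q_expansion[OF assms(4)] by blast
  \<comment> \<open>The square of \<open>y_plus\<close> begins \<open>n\<close> powers of
    \<open>q\<close> after that of \<open>y_minus\<close>, so \<open>c\<close> first enters in the
    coefficient of index \<open>n\<close>.\<close>
  define f where "f = a ^ 2 + fps_const c * fps_X ^ n * b ^ 2"
  have disc_f: "disc_fps f" unfolding f_def by (intro disc_fps_intros a b)
  have f_0: "fps_nth f 0 = 1" using \<open>n > 0\<close> by (simp add: f_def fps_power_zeroth a)
  have F_eq: "F z = qpow (- (real n / 2)) z * q_eval f z" if z: "z \<in> upper_half_plane" for z
  proof -
    have "qpow (real n / 2) z = qpow (- (real n / 2)) z * nome z ^ n"
      unfolding qpow_of_nat [symmetric] qpow_add [symmetric] by simp
    thus ?thesis
      by (simp add: assms(7) a(3)[OF z] b(3)[OF z] f_def q_eval_simps z a(1) b(1) disc_fps_intros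
            power_mult_distrib qpow_power) (simp add: algebra_simps)
  qed
  have F_nz: "\<exists>z\<in>upper_half_plane. F z \<noteq> 0"
  proof (rule ccontr)
    assume "\<not> ?thesis"
    hence "f = 0" using disc_f by (intro q_eval_inj) (auto simp: F_eq)
    thus False using f_0 by simp
  qed
  have F_holo: "F holomorphic_on upper_half_plane"
    using assms(3,5) unfolding assms(7) solves_ode2_def by (auto intro!: holomorphic_intros)
  have F_S: "F (- 1 / z) = - F z / z ^ 2" if z: "z \<in> upper_half_plane" for z
    using assms(9)[OF z] upper_half_plane_nonzero[OF z]
    by (simp add: slash_def mat_S_def vector_2 field_simps)

  \<comment> \<open>Transformation laws under inversion\<close>
  have E4_holo: "q_eval e4 holomorphic_on upper_half_plane"
    by (intro q_eval_holomorphic disc_fps_intros)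
  \<comment> \<open>The potential is a nonzero multiple of \<open>e4\<close>, but its law is known
    only up to the factor \<open>F ^ 2\<close>; this is cancelled because \<open>F\<close> does not
    vanish identically.\<close>
  have E4_S: "q_eval e4 (- 1 / z) = z ^ 4 * q_eval e4 z" if z: "z \<in> upper_half_plane" for z
  proof -
    obtain w where w: "w \<in> upper_half_plane" "F w ^ 2 \<noteq> 0" using F_nz by auto
    have comp: "(\<lambda>z. q_eval e4 (- 1 / z)) holomorphic_on upper_half_plane"
    proof -
      have "(\<lambda>z. - 1 / z) ` upper_half_plane \<subseteq> upper_half_plane" using H by blast
      hence "(q_eval e4 \<circ> (\<lambda>z. - 1 / z)) holomorphic_on upper_half_plane"
        by (intro holomorphic_on_compose_gen[OF _ E4_holo] holomorphic_intros)
           (auto dest: upper_half_plane_nonzero)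
      thus ?thesis by (simp add: o_def)
    qed
    have "q_eval e4 (- 1 / z) - z ^ 4 * q_eval e4 z = 0"
    proof (rule holomorphic_mult_eq_0[where f = "\<lambda>z. q_eval e4 (- 1 / z) - z ^ 4 * q_eval e4 z"
          and g = "\<lambda>z. F z ^ 2" and S = upper_half_plane and w = w])
      show "(\<lambda>z. q_eval e4 (- 1 / z) - z ^ 4 * q_eval e4 z) holomorphic_on upper_half_plane"
        "(\<lambda>z. F z ^ 2) holomorphic_on upper_half_plane"
        by (intro holomorphic_intros comp E4_holo F_holo)+
      fix v assume v: "v \<in> upper_half_plane"
      have "(potential n (- 1 / v) - v ^ 4 * potential n v) * F v ^ 2 = 0"
        unfolding assms(7)
        by (rule potential_weight_4[OF assms(5,3) _ v]) (use F_S in \<open>simp add: assms(7)\<close>)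
      moreover have "potential n (- 1 / v) - v ^ 4 * potential n v =
          - (of_real pi ^ 2 * (of_nat n / 2) ^ 2) * (q_eval e4 (- 1 / v) - v ^ 4 * q_eval e4 v)"
        unfolding potential_def Eisenstein4_eq[OF v] Eisenstein4_eq[OF H[OF v]] by (simp add: algebra_simps)
      ultimately have "- (of_real pi ^ 2 * (of_nat n / 2) ^ 2) *
          ((q_eval e4 (- 1 / v) - v ^ 4 * q_eval e4 v) * F v ^ 2) = 0"
        by (simp only: mult.assoc)
      moreover have "- (of_real pi ^ 2 * (of_nat n / 2) ^ 2) \<noteq> (0 :: complex)"
        using \<open>n > 0\<close> by simp
      ultimately show "(q_eval e4 (- 1 / v) - v ^ 4 * q_eval e4 v) * F v ^ 2 = 0"
        by (simp only: mult_eq_0_iff simp_thms)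
    qed (use w z connected_upper_half_plane in auto)
    thus ?thesis by simp
  qed
  have delta_S: "q_eval delta (- 1 / z) = z ^ 12 * q_eval delta z" if "z \<in> upper_half_plane" for z
    by (rule delta_weight_12[OF E4_S]) (assumption | rule that)+
  have h_S: "?h (- 1 / z) = - (z ^ 6 * ?h z)" if "z \<in> upper_half_plane" for z
    by (rule sqrt_discriminant_weight_6[OF delta_S]) (assumption | rule that)+
  have j_S: "klein_j (- 1 / z) = klein_j z" if z: "z \<in> upper_half_plane" for z
    using upper_half_plane_nonzero[OF z] H[OF z]
    by (simp only: klein_j_def Eisenstein4_eq modular_discriminant_eq z E4_S delta_S)
       (simp add: power_mult_distrib flip: power_mult)

  \<comment> \<open>The invariant function and its pole at the cusp\<close>
  define N where "N = m + 1"
  \<comment> \<open>The weights add up to -2 + 8 - 6 = 0, and the signs of \<open>F\<close> and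
    \<open>?h\<close> cancel. The pole has order \<open>n / 2 + 1 / 2 = N\<close>.\<close>
  define G where "G = (\<lambda>z. F z * q_eval e4 z ^ 2 / ?h z)"
  have G_S: "G (- 1 / z) = G z" if z: "z \<in> upper_half_plane" for z
    unfolding G_def F_S[OF z] E4_S[OF z] h_S[OF z]
    using upper_half_plane_nonzero[OF z] sqrt_discriminant_nonzero[OF z]
    by (simp add: field_simps power_numeral_reduce)
  \<comment> \<open>\<open>J\<close> and \<open>B\<close> are the expansions of
    \<open>nome z * klein_j z\<close> and \<open>nome z ^ N * G z\<close>.\<close>
  define J where "J = e4 ^ 3 * eta_recip ^ 2"
  define B where "B = f * e4 ^ 2 * eta_recip"
  have disc_J: "disc_fps J" and disc_B: "disc_fps B"
    unfolding J_def B_def by (intro disc_fps_intros disc_f)+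
  have e4_0: "fps_nth e4 0 = 1" by (simp add: e4_def)
  have J_0: "fps_nth J 0 = 1" and B_0: "fps_nth B 0 = 1"
    by (simp_all add: J_def B_def f_0 e4_0 eta_recip_0 fps_power_zeroth)
  have rat_J: "rat_fps J"
    unfolding J_def by (intro rat_fps_mult rat_fps_power rat_fps_e4 rat_fps_eta_recip)
  have G_eq: "nome z ^ N * G z = q_eval B z" if z: "z \<in> upper_half_plane" for z
  proof -
    have "qpow (1 / 2) z = nome z ^ N * qpow (- (real n / 2)) z"
      unfolding qpow_of_nat [symmetric] qpow_add [symmetric] by (simp add: N_def n field_simps)
    thus ?thesis
      by (simp add: G_def B_def F_eq z sqrt_discriminant_eq q_eval_simps disc_f disc_fps_intros)
  qed

  \<comment> \<open>Rationality of the polar coefficients\<close>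
  have rat_a: "rat_fps a"
  proof (rule rat_fps_recurrence)
    let ?s = "- (real n / 4)"
    have s: "complex_of_real ?s = - of_nat n / 4" by simp
    show "rat_fps (fps_const (of_real (?s ^ 2)) * (e4 - 1))"
      unfolding of_real_power s using rat_fps_e4
      by (auto simp: rat_fps_def intro!: Rats_mult Rats_power Rats_divide Rats_diff)
    fix j :: nat assume "j > 0"
    \<comment> \<open>Oddness of \<open>n\<close> enters here: the weight
      \<open>j * (2 * j - n) / 2\<close> of the recurrence would vanish at
      \<open>j = n / 2\<close>.\<close>
    have "2 * j \<noteq> n" using \<open>odd n\<close> by auto
    hence "2 * of_nat j - of_nat n \<noteq> (0 :: complex)"
      by (metis eq_iff_diff_eq_0 of_nat_eq_iff of_nat_mult of_nat_numeral)
    moreover have "of_nat j ^ 2 + 2 * complex_of_real ?s * of_nat j =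
        of_nat j * (2 * of_nat j - of_nat n) / 2"
      by (simp add: field_simps power2_eq_square)
    ultimately show "of_nat j ^ 2 + 2 * complex_of_real ?s * of_nat j \<noteq> 0 \<and>
        of_nat j ^ 2 + 2 * complex_of_real ?s * of_nat j \<in> \<rat>"
      using \<open>j > 0\<close> by (auto intro!: Rats_divide Rats_mult Rats_diff)
    show "(of_nat j ^ 2 + 2 * complex_of_real ?s * of_nat j) * fps_nth a j =
        fps_nth (fps_const (of_real (?s ^ 2)) * (e4 - 1) * a) j"
      by (rule ode_recurrence[OF assms(5) a(1,3)]) simp_all
  qed (simp_all add: a e4_0)
  have rat_B: "fps_nth B k \<in> \<rat>" if "k < N" for k
  proof -
    have "B = a ^ 2 * e4 ^ 2 * eta_recip + fps_X ^ n * (fps_const c * b ^ 2 * e4 ^ 2 * eta_recip)"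
      by (simp add: B_def f_def algebra_simps)
    moreover have "k < n" using that by (simp add: N_def n)
    ultimately have "fps_nth B k = fps_nth (a ^ 2 * e4 ^ 2 * eta_recip) k"
      by (simp add: fps_X_power_mult_nth)
    moreover have "rat_fps (a ^ 2 * e4 ^ 2 * eta_recip)"
      by (intro rat_fps_mult rat_fps_power rat_a rat_fps_e4 rat_fps_eta_recip)
    ultimately show ?thesis by (simp add: rat_fps_def)
  qed

  \<comment> \<open>The invariant function as a polynomial in j\<close>
  obtain R E where R: "degree R \<le> N" "coeff R N = 1" "\<And>i. i \<in> {1..N} \<Longrightarrow> coeff R i \<in> \<rat>"
    and B: "B = (\<Sum>i\<le>N. fps_const (coeff R i) * J ^ i * fps_X ^ (N - i)) + fps_X ^ Suc N * E"
    using polar_part_poly[OF rat_J J_0 rat_B] unfolding B_0 by blast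
  have disc_sum: "disc_fps (\<Sum>i\<le>N. fps_const (coeff R i) * J ^ i * fps_X ^ (N - i))"
    by (intro disc_fps_intros disc_J)
  have disc_E: "disc_fps E"
  proof (rule disc_fps_of_X_power_mult)
    have "fps_X ^ Suc N * E = B - (\<Sum>i\<le>N. fps_const (coeff R i) * J ^ i * fps_X ^ (N - i))"
      by (subst B) simp
    thus "disc_fps (fps_X ^ Suc N * E)" using disc_B disc_sum by (simp only: disc_fps_diff)
  qed
  \<comment> \<open>The remainder has an expansion without constant term, so it tends to 0 at the
    cusp; being invariant as well, it must vanish.\<close>
  have G_poly: "G z - poly R (klein_j z) = q_eval (fps_X * E) z" if z: "z \<in> upper_half_plane" for z
  proof -
    have "nome z ^ N * poly R (klein_j z) = (\<Sum>i\<le>N. coeff R i * q_eval J z ^ i * nome z ^ (N - i))"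
      unfolding poly_eq_sum[OF R(1)] sum_distrib_left
    proof (intro sum.cong refl)
      fix i assume "i \<in> {..N}"
      hence "nome z ^ N = nome z ^ (N - i) * nome z ^ i" by (simp flip: power_add)
      thus "nome z ^ N * (coeff R i * klein_j z ^ i) = coeff R i * q_eval J z ^ i * nome z ^ (N - i)"
        by (simp add: klein_j_eq z J_def power_divide)
    qed
    also have "\<dots> = q_eval (\<Sum>i\<le>N. fps_const (coeff R i) * J ^ i * fps_X ^ (N - i)) z"
      by (subst q_eval_sum) (simp_all add: z disc_J disc_fps_intros q_eval_simps)
    also have "\<dots> = q_eval B z - nome z ^ Suc N * q_eval E z"
      by (subst B) (simp add: q_eval_simps z disc_E disc_sum disc_fps_intros del: power_Suc)
    finally have "nome z ^ N * (G z - poly R (klein_j z)) = nome z ^ N * (nome z * q_eval E z)"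
      unfolding G_eq[OF z, symmetric] by (simp add: algebra_simps)
    thus ?thesis by (simp add: q_eval_simps z disc_E)
  qed
  have G_R: "G z = poly R (klein_j z)" if z: "z \<in> upper_half_plane" for z
  proof -
    have "q_eval (fps_X * E) z = 0"
    proof (rule invariant_holomorphic_eq_0[where f = "q_eval (fps_X * E)", OF _ _ _ _ z])
      show "q_eval (fps_X * E) (w + 1) = q_eval (fps_X * E) w" for w
        by (rule q_eval_add_1)
      show "q_eval (fps_X * E) holomorphic_on upper_half_plane"
        by (intro q_eval_holomorphic disc_fps_intros disc_E)
      show "q_eval (fps_X * E) (- 1 / w) = q_eval (fps_X * E) w" if w: "w \<in> upper_half_plane" for w
        by (simp only: G_poly [symmetric] w H G_S j_S)
      show "\<exists>Y>0. \<forall>z. Im z > Y \<longrightarrow> norm (q_eval (fps_X * E) z) < e" if "e > 0" for e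
        using q_eval_tendsto[of "fps_X * E" e] that disc_E by (simp add: disc_fps_intros)
    qed
    thus ?thesis using G_poly[OF z] by simp
  qed

  \<comment> \<open>The factor j of the polynomial\<close>
  obtain r where r: "r \<in> upper_half_plane" "q_eval e4 r = 0"
    by (rule q_eval_e4_elliptic_zero[OF E4_S]) (assumption | rule that)+
  \<comment> \<open>At a zero of \<open>e4\<close> both \<open>G\<close> and \<open>klein_j\<close>
    vanish. This disposes of the one coefficient of \<open>R\<close> not yet known to be
    rational.\<close>
  have "poly R 0 = 0"
    using G_R[OF r(1)] r by (simp add: G_def klein_j_sqrt_discriminant)
  then obtain P where P: "R = pCons 0 P"
    by (metis pCons_cases poly_pCons mult_zero_left add_0_right)
  have coeff_P: "coeff P i = coeff R (Suc i)" for i by (simp add: P)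
  have "coeff P i \<in> \<rat>" for i
    using R by (cases "Suc i \<le> N") (auto simp: coeff_P coeff_eq_0)
  then obtain Q where Q: "map_poly of_rat Q = P" by (rule map_poly_of_rat_exists)
  have "degree P = m"
  proof (rule antisym)
    show "degree P \<le> m" using R(1) by (intro degree_le) (auto simp: coeff_P coeff_eq_0 N_def)
    show "m \<le> degree P" using R(2) by (intro le_degree) (simp add: coeff_P N_def)
  qed
  moreover have "degree (map_poly of_rat Q :: complex poly) = degree Q"
    by (intro degree_map_poly) simp
  ultimately have deg: "degree Q = (n - 1) div 2" using Q n by simp

  \<comment> \<open>Cancelling the square of the Eisenstein series\<close>
  have "F z - q_eval e4 z / ?h z * poly P (klein_j z) = 0" if z: "z \<in> upper_half_plane" for z
  proof -
    obtain w where w: "w \<in> upper_half_plane" "q_eval e4 w ^ 2 \<noteq> 0"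
    proof (rule ccontr)
      assume "\<not> thesis"
      hence "e4 = 0" using that by (intro q_eval_inj) (auto intro: disc_fps_intros)
      thus False using e4_0 by simp
    qed
    \<comment> \<open>Writing j as \<open>q_eval J z / nome z\<close> makes the holomorphy of
      \<open>K\<close> evident. The identity first holds after multiplication by
      \<open>q_eval e4 z ^ 2\<close>, which has zeros, so the identity principle is used instead of
      division.\<close>
    define K where "K = (\<lambda>z. F z - q_eval e4 z / ?h z * poly P (q_eval J z / nome z))"
    have "K z = 0"
    proof (rule holomorphic_mult_eq_0[where f = K and g = "\<lambda>z. q_eval e4 z ^ 2"
          and S = upper_half_plane and w = w])
      have "nome holomorphic_on upper_half_plane"
        unfolding qpow_def [abs_def] by (intro holomorphic_intros)
      thus "K holomorphic_on upper_half_plane"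
        unfolding K_def
        by (intro holomorphic_intros F_holo E4_holo sqrt_discriminant_holomorphic
              q_eval_holomorphic disc_J sqrt_discriminant_nonzero qpow_nonzero)
      show "(\<lambda>z. q_eval e4 z ^ 2) holomorphic_on upper_half_plane"
        by (intro holomorphic_intros E4_holo)
      fix v assume v: "v \<in> upper_half_plane"
      have "F v * q_eval e4 v ^ 2 / ?h v = klein_j v * poly P (klein_j v)"
        using G_R[OF v] by (simp add: G_def P)
      also have "\<dots> = q_eval e4 v ^ 3 / ?h v ^ 2 * poly P (klein_j v)"
        by (simp only: klein_j_sqrt_discriminant[OF v])
      finally have "F v * q_eval e4 v ^ 2 = q_eval e4 v ^ 3 / ?h v * poly P (klein_j v)"
        using sqrt_discriminant_nonzero[OF v] by (simp add: field_simps power2_eq_square)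
      moreover have "q_eval J v / nome v = klein_j v" using klein_j_eq[OF v] by (simp add: J_def)
      ultimately show "K v * q_eval e4 v ^ 2 = 0"
        by (simp add: K_def algebra_simps power2_eq_square power3_eq_cube)
    qed (use w z connected_upper_half_plane in auto)
    thus ?thesis by (simp add: K_def klein_j_eq[OF z] J_def)
  qed
  hence "\<forall>z\<in>upper_half_plane.
      F z = Eisenstein4 z / ?h z * poly (map_poly of_rat Q) (klein_j z)"
    by (simp add: Q Eisenstein4_eq)
  with deg show ?thesis by blast
qed

end
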